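(* Let $\mathcal{A}$ be an integral arrangement of oriented circles and suppose there is a Zariski dense subgroup $\Gamma<\mathrm{PSL}_2(\mathbb{C})$ with $M\mathcal{A}=\mathcal{A}$ for all $M\in\Gamma$. Then there exist an imaginary quadratic field $K$, a number $D$, and an affine map $z\mapsto az+b$ with $a\in\mathbb{C}^{*}$, $b\in\mathbb{C}$ (a scaling, rotation and translation) such that the image of every circle of $\mathcal{A}$ under this map belongs to $\mathcal{S}_D$ (defined with respect to $K$).
   Context: An oriented circle $C$ is determined by data $\zeta\in\mathbb{C}$, $r,\hat r\in\mathbb{R}$ with $|\zeta|^2-r\hat r=1$; as a point set $C=\{\alpha/\beta\in\widehat{\mathbb{C}}: r|\alpha|^2-2\Re(\overline{\alpha}\beta\zeta)+\hat r|\beta|^2=0\}$. Here $r$ is the curvature, $\zeta$ the curvature-center, $\hat r$ the cocurvature, and $\mathbf{v}_C=[\zeta\;\overline{\zeta}\;\hat r\;r]$. If $r\neq0$, $C$ is the circle of center $\zeta/r$ and radius $1/|r|$, with interior the side containing the center if $r>0$ and the other side if $r<0$; if $r=0$, $C$ is a line (together with $\infty$) orthogonal to $\zeta$, with interior the side to which $\zeta$ points. $\mathrm{PSL}_2(\mathbb{C})$ acts on oriented circles by Möbius transformations (preserving orientation): for $M=\begin{bmatrix}\alpha&\gamma\\ \beta&\delta\end{bmatrix}$, $\mathbf{v}_{MC}=\mathbf{v}_C N$ where $N$ has rows $[\alpha\overline{\delta},\ \beta\overline{\gamma},\ \alpha\overline{\gamma},\ \beta\overline{\delta}]$, $[\overline{\beta}\gamma,\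 \overline{\alpha}\delta,\ \overline{\alpha}\gamma,\ \overline{\beta}\delta]$, $[\alpha\overline{\beta},\ \overline{\alpha}\beta,\ |\alpha|^2,\ |\beta|^2]$, $[\gamma\overline{\delta},\ \overline{\gamma}\delta,\ |\gamma|^2,\ |\delta|^2]$. An arrangement is a set of oriented circles; it is integral if there is a real $\lambda\neq0$ such that $\lambda r\in\mathbb{Z}$ for every curvature $r$ of a circle in it. For an imaginary quadratic field $K$ with ring of integers $\mathcal{O}$ and discriminant $\Delta$, write $\sqrt{\Delta}=i\sqrt{|\Delta|}$, and for $D\in\mathbb{R}$ let $\mathcal{S}_D$ be the set of oriented circles $C$ with $i\sqrt{D}\,\mathbf{v}_C\in\mathcal{O}^2\times\sqrt{\Delta}\mathbb{Z}^2$ (i.e. $i\sqrt{D}\zeta,\ i\sqrt{D}\overline{\zeta}\in\mathcal{O}$ and $i\sqrt{D}\hat r,\ i\sqrt{D}r\in\sqrt{\Delta}\mathbb{Z}$). *)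

theory Defs
  imports
    "HOL-Analysis.Analysis"
    "HOL-Algebra.Coset"
    "HOL-Computational_Algebra.Polynomial"
begin

section \<open>Oriented circles\<close>

record oriented_circle =
  ccenter :: complex  \<comment> \<open>curvature-center \<open>\<zeta>\<close>\<close>
  cocurv :: real      \<comment> \<open>cocurvature, \<open>r\<close> with a hat\<close>
  curv :: real        \<comment> \<open>\<open>r\<close>\<close>

definition oriented_circles :: "oriented_circle set" where
  "oriented_circles = {C. (cmod (ccenter C))\<^sup>2 - curv C * cocurv C = 1}"

definition circle_vec :: "oriented_circle \<Rightarrow> complex ^ 4" where
  "circle_vec C = vector [ccenter C, cnj (ccenter C), of_real (cocurv C), of_real (curv C)]"

text \<open>The finite points of \<open>C\<close> are the zeros of \<open>circle_form C\<close>, and the finite points of its interior are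
  those where the form is negative: for \<open>r \<noteq> 0\<close> the value at the center \<open>\<zeta> / r\<close> is \<open>-1 / r\<close>. The form
  serves only to compare the action on data with the action on points.\<close>

definition circle_form :: "oriented_circle \<Rightarrow> complex \<Rightarrow> real" where
  "circle_form C z = curv C * (cmod z)\<^sup>2 - 2 * Re (cnj z * ccenter C) + cocurv C"

definition circle_interior :: "oriented_circle \<Rightarrow> complex set" where
  "circle_interior C = {z. circle_form C z < 0}"


section \<open>The action of \<open>PSL\<^sub>2(\<complex>)\<close>\<close>

definition SL2C :: "(complex ^ 2 ^ 2) monoid" where
  "SL2C = \<lparr>carrier = {A. det A = 1}, mult = (**), one = mat 1\<rparr>"

definition PSL2C :: "(complex ^ 2 ^ 2) set monoid" where
  "PSL2C = SL2C Mod {mat 1, - mat 1}"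

definition circle_rep :: "complex ^ 2 ^ 2 \<Rightarrow> complex ^ 4 ^ 4" where
  "circle_rep A = (let \<alpha> = A $ 1 $ 1; \<gamma> = A $ 1 $ 2; \<beta> = A $ 2 $ 1; \<delta> = A $ 2 $ 2 in
     vector
      [vector [\<alpha> * cnj \<delta>, \<beta> * cnj \<gamma>, \<alpha> * cnj \<gamma>, \<beta> * cnj \<delta>],
       vector [cnj \<beta> * \<gamma>, cnj \<alpha> * \<delta>, cnj \<alpha> * \<gamma>, cnj \<beta> * \<delta>],
       vector [\<alpha> * cnj \<beta>, cnj \<alpha> * \<beta>, of_real ((cmod \<alpha>)\<^sup>2), of_real ((cmod \<beta>)\<^sup>2)],
       vector [\<gamma> * cnj \<delta>, cnj \<gamma> * \<delta>, of_real ((cmod \<gamma>)\<^sup>2), of_real ((cmod \<delta>)\<^sup>2)]])"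

text \<open>The third and fourth coordinates of \<open>circle_vec C v* circle_rep A\<close> are real, so nothing is
  lost by taking real parts; see \<open>circle_vec_circle_act\<close>.\<close>

definition circle_act :: "complex ^ 2 ^ 2 \<Rightarrow> oriented_circle \<Rightarrow> oriented_circle" where
  "circle_act A C = (let v = circle_vec C v* circle_rep A in
     \<lparr>ccenter = v $ 1, cocurv = Re (v $ 3), curv = Re (v $ 4)\<rparr>)"

definition psl_act :: "(complex ^ 2 ^ 2) set \<Rightarrow> oriented_circle \<Rightarrow> oriented_circle" where
  "psl_act M C = circle_act (SOME A. A \<in> M) C"

text \<open>The image under \<open>z \<mapsto> a * z + b\<close>, through the matrix in \<open>SL\<^sub>2(\<complex>)\<close> that induces this map.\<close>

definition affine_matrix :: "complex \<Rightarrow> complex \<Rightarrow> complex ^ 2 ^ 2" where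
  "affine_matrix a b = vector [vector [csqrt a, b / csqrt a], vector [0, 1 / csqrt a]]"

definition affine_act :: "complex \<Rightarrow> complex \<Rightarrow> oriented_circle \<Rightarrow> oriented_circle" where
  "affine_act a b C = circle_act (affine_matrix a b) C"

lemma vector4 [simp]:
  "(vector [w, x, y, z] :: 'a::zero ^ 4) $ 1 = w"
  "(vector [w, x, y, z] :: 'a::zero ^ 4) $ 2 = x"
  "(vector [w, x, y, z] :: 'a::zero ^ 4) $ 3 = y"
  "(vector [w, x, y, z] :: 'a::zero ^ 4) $ 4 = z"
  by (simp_all add: vector_def)

lemma circle_act_simps:
  fixes A C
  defines "\<alpha> \<equiv> A $ 1 $ 1" and "\<gamma> \<equiv> A $ 1 $ 2" and "\<beta> \<equiv> A $ 2 $ 1" and "\<delta> \<equiv> A $ 2 $ 2"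
  shows "ccenter (circle_act A C) = ccenter C * (\<alpha> * cnj \<delta>) + cnj (ccenter C) * (cnj \<beta> * \<gamma>)
           + of_real (cocurv C) * (\<alpha> * cnj \<beta>) + of_real (curv C) * (\<gamma> * cnj \<delta>)"
    and "cocurv (circle_act A C) = 2 * Re (ccenter C * (\<alpha> * cnj \<gamma>))
           + cocurv C * (cmod \<alpha>)\<^sup>2 + curv C * (cmod \<gamma>)\<^sup>2"
    and "curv (circle_act A C) = 2 * Re (ccenter C * (\<beta> * cnj \<delta>))
           + cocurv C * (cmod \<beta>)\<^sup>2 + curv C * (cmod \<delta>)\<^sup>2"
  unfolding assms
  by (simp_all add: circle_act_def circle_rep_def circle_vec_def Let_def vector_matrix_mult_def
      sum_4 algebra_simps cmod_power2)

lemma circle_vec_circle_act: "circle_vec (circle_act A C) = circle_vec C v* circle_rep A"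
  by (simp add: vec_eq_iff forall_4 circle_act_def circle_rep_def circle_vec_def Let_def
      vector_matrix_mult_def sum_4 complex_eq_iff algebra_simps cmod_power2)

lemma circle_act_in_oriented_circles:
  assumes "det A = 1" "C \<in> oriented_circles"
  shows "circle_act A C \<in> oriented_circles"
proof -
  let ?a = "A $ 1 $ 1" and ?c = "A $ 1 $ 2" and ?b = "A $ 2 $ 1" and ?d = "A $ 2 $ 2"
  have *: "(cmod (ccenter (circle_act A C)))\<^sup>2 - curv (circle_act A C) * cocurv (circle_act A C)
    = (cmod (det A))\<^sup>2 * ((cmod (ccenter C))\<^sup>2 - curv C * cocurv C)"
    unfolding circle_act_simps det_2 cmod_power2 by (simp, algebra)
  show ?thesis using assms * by (simp add: oriented_circles_def)
qed

lemma circle_act_uminus: "circle_act (- A) C = circle_act A C"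
  by (rule oriented_circle.equality) (simp_all add: circle_act_simps)

lemma matrix_mult_uminus_left: "(- A :: complex ^ 2 ^ 2) ** B = - (A ** B)"
  by (simp add: vec_eq_iff matrix_matrix_mult_def sum_negf)

lemma matrix_mult_uminus_right: "(A :: complex ^ 2 ^ 2) ** (- B) = - (A ** B)"
  by (simp add: vec_eq_iff matrix_matrix_mult_def sum_negf)

lemma det_uminus_2: "det (- A :: complex ^ 2 ^ 2) = det A"
  by (simp add: det_2)

lemma group_SL2C: "group SL2C"
proof (rule groupI)
  fix A assume "A \<in> carrier SL2C"
  then have d: "det A = 1" by (simp add: SL2C_def)
  then obtain B where B: "B ** A = mat 1"
    using invertible_det_nz[of A] by (auto simp: invertible_def)
  moreover from this have "det B = 1"
    using d by (metis det_I det_mul mult.right_neutral)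
  ultimately show "\<exists>B\<in>carrier SL2C. B \<otimes>\<^bsub>SL2C\<^esub> A = \<one>\<^bsub>SL2C\<^esub>"
    by (auto simp: SL2C_def)
qed (auto simp: SL2C_def det_mul matrix_mul_assoc)

lemma normal_pm_SL2C: "{mat 1, - mat 1} \<lhd> SL2C"
proof -
  interpret group SL2C by (rule group_SL2C)
  have sub: "subgroup {mat 1, - mat 1} SL2C"
  proof (rule subgroupI)
    fix h assume "h \<in> {mat 1, - mat 1 :: complex ^ 2 ^ 2}"
    then have "inv\<^bsub>SL2C\<^esub> h = h"
      by (intro inv_equality) (auto simp: SL2C_def matrix_mult_uminus_left matrix_mult_uminus_right det_uminus_2)
    with \<open>h \<in> _\<close> show "inv\<^bsub>SL2C\<^esub> h \<in> {mat 1, - mat 1}" by simp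
  qed (auto simp: SL2C_def matrix_mult_uminus_left matrix_mult_uminus_right det_uminus_2)
  show ?thesis
  proof (rule normal_invI[OF sub])
    fix x h assume x: "x \<in> carrier SL2C" and h: "h \<in> {mat 1, - mat 1 :: complex ^ 2 ^ 2}"
    have "x ** inv\<^bsub>SL2C\<^esub> x = mat 1" using r_inv[OF x] by (simp add: SL2C_def)
    with h show "x \<otimes>\<^bsub>SL2C\<^esub> h \<otimes>\<^bsub>SL2C\<^esub> inv\<^bsub>SL2C\<^esub> x \<in> {mat 1, - mat 1}"
      by (auto simp: SL2C_def matrix_mult_uminus_left matrix_mult_uminus_right)
  qed
qed

lemma group_PSL2C: "group PSL2C"
  unfolding PSL2C_def by (rule normal.factorgroup_is_group[OF normal_pm_SL2C])

lemma carrier_PSL2C: "carrier PSL2C = {{A, - A} | A. det A = 1}"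
  by (auto simp: PSL2C_def carrier_FactGroup r_coset_def SL2C_def matrix_mult_uminus_left)

lemma psl_act_eq:
  assumes "M \<in> carrier PSL2C" "A \<in> M"
  shows "psl_act M C = circle_act A C"
proof -
  obtain B where M: "M = {B, - B}"
    using assms(1) by (auto simp: carrier_PSL2C)
  have "(SOME A. A \<in> M) \<in> M" using assms(2) by (rule someI)
  then show ?thesis using assms(2) unfolding psl_act_def M by (auto simp: circle_act_uminus)
qed

text \<open>\<open>circle_form\<close> at a finite point whose image \<open>w\<close> under the Moebius map is finite as well\<close>

lemma circle_form_circle_act:
  assumes "det A = 1" "A $ 2 $ 1 * z + A $ 2 $ 2 \<noteq> 0"
    and "w = (A $ 1 $ 1 * z + A $ 1 $ 2) / (A $ 2 $ 1 * z + A $ 2 $ 2)"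
  shows "circle_form C z = circle_form (circle_act A C) w * (cmod (A $ 2 $ 1 * z + A $ 2 $ 2))\<^sup>2"
proof -
  define n d where "n = A $ 1 $ 1 * z + A $ 1 $ 2" and "d = A $ 2 $ 1 * z + A $ 2 $ 2"
  let ?C = "circle_act A C"
  have d0: "d \<noteq> 0" and w: "w = n / d" using assms by (simp_all add: n_def d_def)
  have "circle_form ?C w * (cmod d)\<^sup>2
      = curv ?C * (cmod n)\<^sup>2 - 2 * Re (cnj n * d * ccenter ?C) + cocurv ?C * (cmod d)\<^sup>2"
  proof -
    have 1: "(cmod w)\<^sup>2 * (cmod d)\<^sup>2 = (cmod n)\<^sup>2"
      using d0 by (simp add: w norm_divide power_divide)
    have "cnj w * of_real ((cmod d)\<^sup>2) = cnj n * d"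
      using d0 by (simp add: w complex_norm_square del: of_real_power)
    then have "cnj n * d * ccenter ?C = (cnj w * ccenter ?C) * of_real ((cmod d)\<^sup>2)"
      by (simp add: algebra_simps)
    then have 2: "Re (cnj n * d * ccenter ?C) = Re (cnj w * ccenter ?C) * (cmod d)\<^sup>2"
      by (metis Re_complex_of_real Im_complex_of_real mult_zero_right diff_zero times_complex.sel(1))
    show ?thesis unfolding 2 1[symmetric] circle_form_def by (simp add: algebra_simps)
  qed
  also have "\<dots> = (cmod (det A))\<^sup>2 * circle_form C z"
    unfolding circle_form_def circle_act_simps det_2 cmod_power2 n_def d_def by (simp, algebra)
  finally show ?thesis using assms(1) by (simp add: d_def)
qed

lemma affine_act_interior:
  assumes "a \<noteq> 0"
  shows "circle_interior (affine_act a b C) = (\<lambda>z. a * z + b) ` circle_interior C"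
proof -
  have s: "csqrt a \<noteq> 0" "csqrt a * csqrt a = a" using assms by (simp_all flip: power2_eq_square)
  let ?A = "affine_matrix a b"
  have "circle_form C z = circle_form (affine_act a b C) (a * z + b) * (cmod (1 / csqrt a))\<^sup>2" for z
  proof -
    have w: "a * z + b = (?A $ 1 $ 1 * z + ?A $ 1 $ 2) / (?A $ 2 $ 1 * z + ?A $ 2 $ 2)"
      using s by (simp add: affine_matrix_def divide_simps)
    show ?thesis
      unfolding affine_act_def using circle_form_circle_act[OF _ _ w, of C] s
      by (simp add: det_2 affine_matrix_def)
  qed
  moreover have "(cmod (1 / csqrt a))\<^sup>2 > 0" using s by simp
  ultimately have iff: "circle_form C z < 0 \<longleftrightarrow> circle_form (affine_act a b C) (a * z + b) < 0" for z
    by (simp add: mult_less_0_iff)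
  show ?thesis
  proof (rule Set.set_eqI)
    fix w
    define z where "z = (w - b) / a"
    have w: "w = a * z + b" using assms by (simp add: z_def)
    have "w \<in> (\<lambda>z. a * z + b) ` circle_interior C \<longleftrightarrow> z \<in> circle_interior C"
      using assms by (auto simp: w)
    then show "w \<in> circle_interior (affine_act a b C) \<longleftrightarrow> w \<in> (\<lambda>z. a * z + b) ` circle_interior C"
      using iff[of z] by (simp add: circle_interior_def w)
  qed
qed


section \<open>Zariski density\<close>

text \<open>\<open>PSL\<^sub>2(\<complex>)\<close> is regarded as a real algebraic group: closed sets are cut out by real polynomials in
  the real and imaginary parts of the matrix entries. The topology given by polynomials in the
  entries alone is coarser: in it even the image of \<open>SL\<^sub>2(\<int>)\<close> is dense.\<close>

definition zariski_closed :: "(complex ^ 2 ^ 2) set set \<Rightarrow> bool" where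
  "zariski_closed Z \<longleftrightarrow> (\<exists>P. (\<forall>p\<in>P. real_polynomial_function p) \<and>
     Z = {M \<in> carrier PSL2C. \<forall>A\<in>M. \<forall>p\<in>P. p A = 0})"

definition zariski_dense :: "(complex ^ 2 ^ 2) set set \<Rightarrow> bool" where
  "zariski_dense \<Gamma> \<longleftrightarrow> (\<forall>Z. zariski_closed Z \<and> \<Gamma> \<subseteq> Z \<longrightarrow> Z = carrier PSL2C)"


section \<open>Arrangements and the sets \<open>\<S>\<^sub>D\<close>\<close>

definition arrangement :: "oriented_circle set \<Rightarrow> bool" where
  "arrangement \<A> \<longleftrightarrow> \<A> \<subseteq> oriented_circles"

definition integral_arrangement :: "oriented_circle set \<Rightarrow> bool" where
  "integral_arrangement \<A> \<longleftrightarrow>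
     arrangement \<A> \<and> (\<exists>l::real. l \<noteq> 0 \<and> (\<forall>C\<in>\<A>. l * curv C \<in> \<int>))"

text \<open>Imaginary quadratic fields are taken inside \<open>\<complex>\<close>.\<close>

definition imaginary_quadratic_field :: "complex set \<Rightarrow> bool" where
  "imaginary_quadratic_field K \<longleftrightarrow>
     1 \<in> K \<and> (\<forall>x\<in>K. \<forall>y\<in>K. x - y \<in> K \<and> x * y \<in> K) \<and> (\<forall>x\<in>K. inverse x \<in> K) \<and>
     vector_space.dim (\<lambda>(q::rat) (z::complex). of_rat q * z) K = 2 \<and> \<not> K \<subseteq> \<real>"

definition ring_of_integers :: "complex set \<Rightarrow> complex set" where
  "ring_of_integers K = {x \<in> K. algebraic_int x}"

definition integral_basis :: "complex set \<Rightarrow> complex \<Rightarrow> complex \<Rightarrow> bool" where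
  "integral_basis K w1 w2 \<longleftrightarrow>
     bij_betw (\<lambda>(m::int, n::int). of_int m * w1 + of_int n * w2) UNIV (ring_of_integers K)"

text \<open>The two embeddings of an imaginary quadratic field are the identity and \<open>cnj\<close>.\<close>

definition field_disc :: "complex set \<Rightarrow> int" where
  "field_disc K = (THE \<Delta>. \<exists>w1 w2. integral_basis K w1 w2 \<and> of_int \<Delta> = (w1 * cnj w2 - w2 * cnj w1)\<^sup>2)"

definition sqrt_disc :: "complex set \<Rightarrow> complex" where
  "sqrt_disc K = \<i> * of_real (sqrt \<bar>of_int (field_disc K)\<bar>)"

text \<open>\<open>csqrt\<close> gives \<open>\<surd>D\<close> for negative \<open>D\<close> as well. For \<open>D = 0\<close> the four conditions are void and
  \<open>S_circles K 0\<close> is the set of all oriented circles, so a statement about some \<open>D\<close> has to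
  exclude this value.\<close>

definition S_circles :: "complex set \<Rightarrow> real \<Rightarrow> oriented_circle set" where
  "S_circles K D = {C \<in> oriented_circles.
     \<i> * csqrt (of_real D) * ccenter C \<in> ring_of_integers K \<and>
     \<i> * csqrt (of_real D) * cnj (ccenter C) \<in> ring_of_integers K \<and>
     (\<exists>m::int. \<i> * csqrt (of_real D) * of_real (cocurv C) = sqrt_disc K * of_int m) \<and>
     (\<exists>n::int. \<i> * csqrt (of_real D) * of_real (curv C) = sqrt_disc K * of_int n)}"

end

theory Submission
  imports Defs
begin

text \<open>
  Identify oriented circles with the vectors of norm \<open>1\<close> in Minkowski space \<open>\<real>\<^sup>4\<close>. By Zariski density the
  circles of \<open>\<A>\<close> span \<open>\<real>\<^sup>4\<close>, and four translates of the curvature functional form a basis of the dual space;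
  since they are integral up to scaling, \<open>\<A>\<close> lies in a lattice on whose rational span \<open>\<Gamma>\<close> acts. The
  invariant bilinear forms are the multiples of the Minkowski form and at the same time the solutions of a linear system
  over \<open>\<rat>\<close>, so the Minkowski form, being \<open>1\<close> on \<open>\<A>\<close>, is rational on the lattice. After the center of one
  circle is moved to \<open>0\<close>, the curvature-centers therefore have rational inner products, which puts a common
  multiple of them into an imaginary quadratic field, and the denominators are bounded because a lattice is finitely generated.
\<close>

section \<open>Algebraic integers of degree two\<close>

lemma common_denominator:
  assumes "finite F" "F \<subseteq> (\<rat> :: 'a::field_char_0 set)"
  shows "\<exists>d::int. d > 0 \<and> (\<forall>x\<in>F. of_int d * x \<in> \<int>)"
  using assms
proof (induction F rule: finite_induct)
  case empty
  show ?case by (rule exI[of _ 1]) simp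
next
  case (insert x F)
  then obtain d :: int where d: "d > 0" "\<forall>x\<in>F. of_int d * x \<in> \<int>" by auto
  obtain a b :: int where ab: "b > 0" "x = of_int a / of_int b"
    using insert.prems by (auto elim: Rats_cases')
  have "of_int (d * b) * y \<in> \<int>" if "y \<in> insert x F" for y
  proof (cases "y = x")
    case True
    then have "of_int (d * b) * y = of_int (d * a)" using ab by simp
    then show ?thesis by (metis Ints_of_int)
  next
    case False
    then have "of_int d * y \<in> \<int>" using that d by auto
    then have "of_int b * (of_int d * y) \<in> \<int>" by (rule Ints_mult[OF Ints_of_int])
    then show ?thesis by (simp add: mult_ac)
  qed
  then show ?case using d(1) ab(1) by (intro exI[of _ "d * b"]) auto
qed

lemma integral_multiple_poly:
  fixes q :: "'a::field_char_0 poly"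
  assumes "\<And>i. coeff q i \<in> \<rat>"
  obtains d :: int and Q :: "int poly"
  where "d > 0" "\<And>i. of_int (coeff Q i) = of_int d * coeff q i"
proof -
  have "\<exists>d::int. d > 0 \<and> (\<forall>x\<in>set (coeffs q). of_int d * x \<in> \<int>)"
    using assms by (intro common_denominator) (auto simp: coeffs_def)
  then obtain d :: int where d: "d > 0" "\<forall>x\<in>set (coeffs q). of_int d * x \<in> \<int>" by blast
  have int: "of_int d * coeff q i \<in> \<int>" for i
    using d(2) coeff_in_coeffs[of q i] by (cases "q = 0 \<or> degree q < i") (auto simp: coeff_eq_0)
  \<comment> \<open>\<open>t\<close> picks integer preimages. The value 0 at 0 is built in because
    \<open>map_poly\<close> acts coefficientwise only for functions that fix 0.\<close>
  define t where "t = (\<lambda>x::'a. if x = 0 then 0 else SOME k::int. x = of_int k)"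
  have t: "of_int (t x) = x" if "x \<in> \<int>" for x
    using that someI_ex[of "\<lambda>k. x = of_int k"] by (auto simp: t_def Ints_def)
  have t0: "t 0 = 0" by (simp add: t_def)
  show ?thesis
  proof (rule that[OF d(1)])
    show "of_int (coeff (map_poly t (smult (of_int d) q)) i) = of_int d * coeff q i" for i
      using t[OF int[of i]] by (subst coeff_map_poly) (simp_all add: t0)
  qed
qed

text \<open>Gauss's lemma. Clearing denominators gives \<open>M * H = smult (a * b) P\<close> with
  \<open>P\<close> primitive, since \<open>p\<close> is monic, so the contents of \<open>M\<close>
  and \<open>H\<close> multiply to \<open>a * b\<close>. They divide the leading coefficients
  \<open>a\<close> and \<open>b\<close>; hence \<open>content M = a\<close>, and \<open>a\<close>
  divides every coefficient of \<open>M\<close>.\<close>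

lemma gauss_monic_factor_integral:
  fixes p m h :: "'a::field_char_0 poly"
  assumes p: "lead_coeff p = 1" "\<And>i. coeff p i \<in> \<int>"
    and m: "lead_coeff m = 1" "\<And>i. coeff m i \<in> \<rat>"
    and h: "\<And>i. coeff h i \<in> \<rat>" and eq: "p = m * h"
  shows "coeff m i \<in> \<int>"
proof -
  obtain a M where a: "a > 0" and M: "\<And>i. of_int (coeff M i) = of_int a * coeff m i"
    using integral_multiple_poly[OF m(2)] by blast
  obtain b H where b: "b > 0" and H: "\<And>i. of_int (coeff H i) = of_int b * coeff h i"
    using integral_multiple_poly[OF h] by blast
  obtain P where P: "\<And>i. of_int (coeff P i) = coeff p i"
  proof -
    have "\<exists>k::int. coeff p i = of_int k" for i using p(2)[of i] by (auto simp: Ints_def)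
    then obtain f where f: "\<And>i. coeff p i = of_int (f i)" by metis
    have "\<forall>\<^sub>\<infinity>i. f i = 0" using MOST_coeff_eq_0[of p] by (simp add: f)
    then show ?thesis by (intro that[of "Abs_poly f"]) (simp add: Abs_poly_inverse f)
  qed
  have lh: "lead_coeff h = 1" using p(1) m(1) by (simp add: eq lead_coeff_mult)
  have "M * H = smult (a * b) P"
  proof (rule poly_eqI)
    fix n
    have "of_int (coeff (M * H) n) = (of_int (coeff (smult (a * b) P) n) :: 'a)"
      by (simp add: coeff_mult M H P eq sum_distrib_left mult_ac)
    then show "coeff (M * H) n = coeff (smult (a * b) P) n" by (simp only: of_int_eq_iff)
  qed
  then have "content M * content H = content (smult (a * b) P)" by (metis content_mult)
  moreover have "content P = 1"
  proof -
    have "coeff P (degree p) = 1" using P[of "degree p"] p(1) by (metis of_int_eq_1_iff)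
    then show ?thesis by (metis content_dvd_coeff is_unit_content_iff)
  qed
  ultimately have ab: "content M * content H = a * b" using a b by simp
  have "coeff M (degree m) = a" "coeff H (degree h) = b"
    using M[of "degree m"] H[of "degree h"] m(1) lh by simp_all
  then have "content M dvd a" "content H dvd b" by (metis content_dvd_coeff)+
  then have le: "content M \<le> a" "content H \<le> b" using a b zdvd_imp_le by auto
  have "content M \<ge> 0" "content H \<ge> 0" by (metis abs_ge_zero normalize_content normalize_int_def abs_of_nonneg)+
  have "content M = a"
  proof (rule ccontr)
    assume "content M \<noteq> a"
    then have "content M * content H < a * b"
      using le \<open>content M \<ge> 0\<close> \<open>content H \<ge> 0\<close> a b
      by (smt (verit) mult_le_cancel_left mult_less_cancel_right)
    then show False using ab by simp
  qed
  then obtain k where "coeff M i = a * k" by (metis content_dvd_coeff dvdE)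
  with M[of i] a have "coeff m i = of_int k" by simp
  then show ?thesis by simp
qed

text \<open>Along with the nonreal root \<open>z\<close> the integral polynomial \<open>p\<close>
  has the different root \<open>cnj z\<close>, so \<open>[:N, - T, 1:]\<close> divides
  \<open>p\<close>, and Gauss's lemma applies to this factor.\<close>

lemma algebraic_int_nonreal:
  fixes z :: complex
  assumes z: "algebraic_int z" "z \<notin> \<real>" and tr: "2 * Re z \<in> \<rat>" and nm: "(cmod z)\<^sup>2 \<in> \<rat>"
  shows "2 * Re z \<in> \<int>" and "(cmod z)\<^sup>2 \<in> \<int>"
proof -
  obtain p where p: "lead_coeff p = 1" "\<forall>i. coeff p i \<in> \<int>" "poly p z = 0"
    using z(1) by (auto simp: algebraic_int.simps)
  define T N where "T = complex_of_real (2 * Re z)" and "N = complex_of_real ((cmod z)\<^sup>2)"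
  define m where "m = [:N, - T, 1:]"
  have TN: "z + cnj z = T" "z * cnj z = N"
    unfolding T_def N_def by (simp_all add: complex_add_cnj complex_norm_square del: of_real_power)
  have m: "m = [:- z, 1:] * [:- cnj z, 1:]" by (simp add: m_def TN[symmetric])
  have ne: "cnj z \<noteq> z" using z(2) by (metis Reals_cnj_iff)
  have "map_poly cnj p = p"
  proof (rule poly_eqI)
    show "coeff (map_poly cnj p) n = coeff p n" for n
      using p(2)[rule_format, of n] by (auto simp: coeff_map_poly elim!: Ints_cases)
  qed
  then have pc: "poly p (cnj z) = 0" using p(3) by (metis complex_cnj_zero poly_cnj)
  obtain q where q: "p = [:- z, 1:] * q" using p(3) by (metis poly_eq_0_iff_dvd dvdE)
  have "poly q (cnj z) = 0" using pc ne by (simp add: q)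
  then obtain h where "q = [:- cnj z, 1:] * h" by (metis poly_eq_0_iff_dvd dvdE)
  then have eq: "p = m * h" by (simp only: q m mult.assoc)
  have TNQ: "T \<in> \<rat>" "N \<in> \<rat>" using tr nm by (auto simp: T_def N_def simp del: of_real_power of_real_mult elim!: Rats_cases)
  have "coeff h n \<in> \<rat>" for n
  \<comment> \<open>Downward induction: comparing coefficients of degree \<open>n + 2\<close> in
    \<open>p = m * h\<close> expresses \<open>coeff h n\<close> through the two next higher
    coefficients of \<open>h\<close>, which vanish beyond the degree.\<close>
  proof (induction "Suc (degree h) - n" arbitrary: n rule: less_induct)
    case less
    show ?case
    proof (cases "n > degree h")
      case True
      then show ?thesis by (simp add: coeff_eq_0)
    next
      case False
      have "coeff p (n + 2) = N * coeff h (n + 2) - T * coeff h (n + 1) + coeff h n"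
        by (simp add: eq m_def numeral_2_eq_2)
      moreover have "coeff h (n + 1) \<in> \<rat>" "coeff h (n + 2) \<in> \<rat>"
        using less False by simp_all
      moreover have "coeff p (n + 2) \<in> \<rat>" using p(2) Ints_subset_Rats by blast
      ultimately have "coeff p (n + 2) - N * coeff h (n + 2) + T * coeff h (n + 1) \<in> \<rat>"
        using TNQ by (intro Rats_add Rats_diff Rats_mult) auto
      then show ?thesis using \<open>coeff p (n + 2) = _\<close> by simp
    qed
  qed
  moreover have "coeff m i \<in> \<rat>" for i
    using TNQ by (auto simp: m_def coeff_pCons split: nat.split)
  ultimately have int: "coeff m i \<in> \<int>" for i
    using p by (intro gauss_monic_factor_integral[OF _ _ _ _ _ eq]) (auto simp: m_def)
  have "T \<in> \<int>" using int[of 1] by (simp add: m_def)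
  then show "2 * Re z \<in> \<int>" by (simp only: T_def of_real_in_Ints_iff)
  have "N \<in> \<int>" using int[of 0] by (simp add: m_def)
  then show "(cmod z)\<^sup>2 \<in> \<int>" by (simp only: N_def of_real_in_Ints_iff)
qed

section \<open>Imaginary quadratic fields\<close>

text \<open>For \<open>s > 0\<close> with \<open>s\<^sup>2\<close> rational this is the field
  generated over the rationals by \<open>\<i> * s\<close>, written in coordinates; a rational
  \<open>s\<close> gives the Gaussian field.\<close>

definition quadratic_field :: "real \<Rightarrow> complex set" where
  "quadratic_field s = {z. Re z \<in> \<rat> \<and> Im z / s \<in> \<rat>}"

locale quadratic_irrationality =
  fixes s :: real
  assumes s_pos: "s > 0" and s_square: "s\<^sup>2 \<in> \<rat>"
begin

abbreviation "K \<equiv> quadratic_field s"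
abbreviation "\<O> \<equiv> ring_of_integers K"

lemma quadratic_fieldI: "p \<in> \<rat> \<Longrightarrow> q \<in> \<rat> \<Longrightarrow> Complex p (q * s) \<in> K"
  using s_pos by (simp add: quadratic_field_def)

lemma quadratic_fieldE:
  assumes "z \<in> K"
  obtains p q where "p \<in> \<rat>" "q \<in> \<rat>" "z = Complex p (q * s)"
  using assms s_pos that[of "Re z" "Im z / s"] by (simp add: quadratic_field_def)

lemma norm_rational:
  assumes "z \<in> K"
  shows "(cmod z)\<^sup>2 \<in> \<rat>"
proof -
  obtain p q where pq: "p \<in> \<rat>" "q \<in> \<rat>" "z = Complex p (q * s)" using quadratic_fieldE[OF assms] .
  then have "(cmod z)\<^sup>2 = p\<^sup>2 + q\<^sup>2 * s\<^sup>2" by (simp add: cmod_power2 power_mult_distrib)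
  then show ?thesis using pq s_square by simp
qed

lemma mult_closed:
  assumes "x \<in> K" "y \<in> K"
  shows "x * y \<in> K"
proof -
  obtain p q where pq: "p \<in> \<rat>" "q \<in> \<rat>" "x = Complex p (q * s)" using quadratic_fieldE[OF assms(1)] .
  obtain p' q' where pq': "p' \<in> \<rat>" "q' \<in> \<rat>" "y = Complex p' (q' * s)" using quadratic_fieldE[OF assms(2)] .
  have "x * y = Complex (p * p' - q * q' * s\<^sup>2) ((p * q' + q * p') * s)"
    by (simp add: pq pq' complex_eq_iff algebra_simps power2_eq_square)
  then show ?thesis using pq pq' s_square by (auto intro!: quadratic_fieldI)
qed

lemma inverse_closed:
  assumes "x \<in> K"
  shows "inverse x \<in> K"
proof -
  obtain p q where pq: "p \<in> \<rat>" "q \<in> \<rat>" "x = Complex p (q * s)" using quadratic_fieldE[OF assms] .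
  have "inverse x = Complex (p / (cmod x)\<^sup>2) ((- q / (cmod x)\<^sup>2) * s)"
    by (simp add: pq complex_eq_iff cmod_power2)
  moreover have "p / (cmod x)\<^sup>2 \<in> \<rat>" "- q / (cmod x)\<^sup>2 \<in> \<rat>"
    using pq norm_rational[OF assms] by (auto intro!: Rats_divide simp del: minus_divide_left)
  ultimately show ?thesis using quadratic_fieldI by metis
qed

lemma diff_closed:
  assumes "x \<in> K" "y \<in> K"
  shows "x - y \<in> K"
  using assms by (simp add: quadratic_field_def diff_divide_distrib)

lemma Im_mult_rational:
  assumes "x \<in> K" "y \<in> K"
  shows "Im x * Im y \<in> \<rat>"
proof -
  obtain p q where pq: "p \<in> \<rat>" "q \<in> \<rat>" "x = Complex p (q * s)" using quadratic_fieldE[OF assms(1)] .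
  obtain p' q' where pq': "p' \<in> \<rat>" "q' \<in> \<rat>" "y = Complex p' (q' * s)" using quadratic_fieldE[OF assms(2)] .
  have "Im x * Im y = q * q' * s\<^sup>2" by (simp add: pq pq' power2_eq_square)
  moreover have "q * q' * s\<^sup>2 \<in> \<rat>" using pq pq' s_square by simp
  ultimately show ?thesis by simp
qed

lemma dim_quadratic_field: "vector_space.dim (\<lambda>(q::rat) (z::complex). of_rat q * z) K = 2"
proof -
  interpret vs: vector_space "\<lambda>(q::rat) (z::complex). of_rat q * z"
    by unfold_locales (simp_all add: algebra_simps of_rat_add of_rat_mult)
  have re_im: "Re (of_rat q) = of_rat q" "Im (of_rat q) = 0" for q
    by (cases q; simp add: of_rat_rat)+
  let ?i = "\<i> * complex_of_real s"
  have ne: "1 \<noteq> ?i" using arg_cong[of 1 ?i Re] by auto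
  show ?thesis
  proof (rule vs.dim_unique)
    show "{1, ?i} \<subseteq> K" using s_pos by (auto simp: quadratic_field_def)
    show "K \<subseteq> vs.span {1, ?i}"
    proof
      fix z assume "z \<in> K"
      then obtain p q where "Re z = of_rat p" "Im z / s = of_rat q"
        by (auto simp: quadratic_field_def elim!: Rats_cases)
      then have "z = of_rat p * 1 + of_rat q * ?i"
        using s_pos by (simp add: complex_eq_iff re_im field_simps)
      moreover have "of_rat p * 1 + of_rat q * ?i \<in> vs.span {1, ?i}"
        by (intro vs.span_add vs.span_scale vs.span_base) auto
      ultimately show "z \<in> vs.span {1, ?i}" by simp
    qed
    have "?i \<notin> vs.span {1}"
    proof
      assume "?i \<in> vs.span {1}"
      then obtain q where "?i = of_rat q * 1" by (auto simp: vs.span_singleton)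
      then have "Im ?i = Im (of_rat q)" by simp
      then show False using s_pos by (simp add: re_im)
    qed
    moreover have "vs.independent {1}" by (subst vs.independent_insert) (auto simp: vs.independent_empty)
    ultimately have "vs.independent (insert ?i {1})" by (subst vs.independent_insert) auto
    then show "vs.independent {1, ?i}" by (simp add: insert_commute)
    show "card {1, ?i} = 2" using ne by simp
  qed
qed

lemma imaginary_quadratic_field: "imaginary_quadratic_field K"
proof -
  have "\<i> * complex_of_real s \<in> K" "\<i> * complex_of_real s \<notin> \<real>"
    using s_pos by (auto simp: quadratic_field_def complex_is_Real_iff)
  then have "\<not> K \<subseteq> \<real>" by blast
  moreover have "1 \<in> K" by (simp add: quadratic_field_def)
  ultimately show ?thesis
    by (simp add: imaginary_quadratic_field_def mult_closed diff_closed inverse_closed dim_quadratic_field)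
qed

section \<open>The ring of integers as a lattice\<close>

lemma mem_ring_of_integers_iff: "z \<in> \<O> \<longleftrightarrow> z \<in> K \<and> 2 * Re z \<in> \<int> \<and> (cmod z)\<^sup>2 \<in> \<int>"
proof (intro iffI conjI; (elim conjE)?)
  assume "z \<in> \<O>"
  then have z: "z \<in> K" "algebraic_int z" by (simp_all add: ring_of_integers_def)
  show "z \<in> K" by fact
  have "2 * Re z \<in> \<int> \<and> (cmod z)\<^sup>2 \<in> \<int>"
  proof (cases "z \<in> \<real>")
    case True
    then have "z = of_real (Re z)" by (simp add: complex_is_Real_iff complex_eq_iff)
    moreover have "Re z \<in> \<rat>" using z by (simp add: quadratic_field_def)
    ultimately have "z \<in> \<rat>" by (auto elim!: Rats_cases')
    with z have "z \<in> \<int>" by (intro rational_algebraic_int_is_int)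
    then show ?thesis by (auto elim!: Ints_cases simp del: of_int_power simp flip: of_int_power)
  next
    case False
    have "2 * Re z \<in> \<rat>" using z by (simp add: quadratic_field_def)
    then show ?thesis using algebraic_int_nonreal[OF z(2) False] norm_rational[OF z(1)] by blast
  qed
  then show "2 * Re z \<in> \<int>" "(cmod z)\<^sup>2 \<in> \<int>" by blast+
next
  assume z: "z \<in> K" and int: "2 * Re z \<in> \<int>" "(cmod z)\<^sup>2 \<in> \<int>"
  let ?p = "[:complex_of_real ((cmod z)\<^sup>2), - complex_of_real (2 * Re z), 1:]"
  have "algebraic_int z"
  proof (rule algebraic_int.intros[of ?p])
    show "\<forall>i. coeff ?p i \<in> \<int>"
      using int by (auto simp: coeff_pCons simp del: of_real_mult of_real_power split: nat.split)
    show "poly ?p z = 0"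
      unfolding complex_norm_square complex_add_cnj[symmetric] by (simp add: algebra_simps)
  qed simp
  with z show "z \<in> \<O>" by (simp add: ring_of_integers_def)
qed

text \<open>This is the cross term in the norm of \<open>z - w\<close>, needed for closure of
  \<open>\<O>\<close> under differences. The number \<open>x\<close> is rational with integral
  square, hence an integer \<open>y\<close>, and the formula for \<open>y\<^sup>2\<close> gives
  \<open>y\<close> the parity of \<open>t * t'\<close>. So \<open>t * t' + y\<close>, which is twice
  the pairing, is even.\<close>

lemma trace_pairing_integral:
  assumes z: "z \<in> \<O>" and w: "w \<in> \<O>"
  shows "2 * Re (z * cnj w) \<in> \<int>"
proof -
  obtain t n where tn: "2 * Re z = of_int t" "(cmod z)\<^sup>2 = of_int n"
    using z by (auto simp: mem_ring_of_integers_iff elim!: Ints_cases)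
  obtain t' n' where tn': "2 * Re w = of_int t'" "(cmod w)\<^sup>2 = of_int n'"
    using w by (auto simp: mem_ring_of_integers_iff elim!: Ints_cases)
  define x where "x = 4 * (Im z * Im w)"
  have "(2 * Im u)\<^sup>2 = 4 * (cmod u)\<^sup>2 - (2 * Re u)\<^sup>2" for u
    by (simp add: cmod_power2 power_mult_distrib)
  from this[of z] this[of w]
  have sq: "(2 * Im z)\<^sup>2 = of_int (4 * n - t\<^sup>2)" "(2 * Im w)\<^sup>2 = of_int (4 * n' - t'\<^sup>2)"
    unfolding tn tn' by simp_all
  have "x\<^sup>2 = (2 * Im z)\<^sup>2 * (2 * Im w)\<^sup>2" by (simp add: x_def power_mult_distrib)
  then have x2: "x\<^sup>2 = of_int ((4 * n - t\<^sup>2) * (4 * n' - t'\<^sup>2))" by (simp only: sq of_int_mult)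
  have "Im z * Im w \<in> \<rat>" using z w Im_mult_rational by (simp add: mem_ring_of_integers_iff)
  then have "x \<in> \<rat>" by (simp add: x_def)
  moreover have "algebraic_int x"
  proof -
    have "algebraic_int (sqrt (x\<^sup>2))" by (rule algebraic_int_sqrt) (simp only: x2 algebraic_int_of_int)
    then show ?thesis by (simp only: real_sqrt_abs algebraic_int_abs_real)
  qed
  ultimately have "x \<in> \<int>" by (intro rational_algebraic_int_is_int)
  then obtain y where y: "x = of_int y" by (auto elim: Ints_cases)
  have "y\<^sup>2 = (4 * n - t\<^sup>2) * (4 * n' - t'\<^sup>2)"
    using x2 unfolding y by (metis of_int_eq_iff of_int_power)
  then have "even (y\<^sup>2) \<longleftrightarrow> even (4 * n - t\<^sup>2) \<or> even (4 * n' - t'\<^sup>2)"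
    by (simp only: even_mult_iff)
  then have "even y \<longleftrightarrow> even t \<or> even t'" by simp
  then have "even (t * t' + y)" by simp
  then obtain k where k: "t * t' + y = 2 * k" by (rule evenE)
  have "2 * (2 * Re (z * cnj w)) = of_int (t * t' + y)"
    by (simp flip: tn tn' y add: x_def)
  then have "2 * Re (z * cnj w) = of_int k" by (simp add: k)
  then show ?thesis by simp
qed

lemma ring_of_integers_diff:
  assumes z: "z \<in> \<O>" and w: "w \<in> \<O>"
  shows "z - w \<in> \<O>"
proof -
  have "2 * Re (z - w) = 2 * Re z - 2 * Re w"
    "(cmod (z - w))\<^sup>2 = (cmod z)\<^sup>2 - 2 * Re (z * cnj w) + (cmod w)\<^sup>2"
    unfolding cmod_power2 by (simp_all add: power2_eq_square algebra_simps)
  moreover have "2 * Re z - 2 * Re w \<in> \<int>" "(cmod z)\<^sup>2 - 2 * Re (z * cnj w) + (cmod w)\<^sup>2 \<in> \<int>"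
    using z w trace_pairing_integral[OF z w] unfolding mem_ring_of_integers_iff
    by (blast intro: Ints_diff Ints_add)+
  moreover have "z - w \<in> K"
    using z w diff_closed by (simp add: mem_ring_of_integers_iff)
  ultimately show ?thesis by (simp only: mem_ring_of_integers_iff)
qed

lemma ring_of_integers_of_int_mult:
  assumes "w \<in> \<O>"
  shows "of_int k * w \<in> \<O>"
proof -
  have "2 * Re (of_int k * w) = of_int k * (2 * Re w)"
    "(cmod (of_int k * w))\<^sup>2 = of_int (k\<^sup>2) * (cmod w)\<^sup>2"
    by (simp_all add: norm_mult power_mult_distrib)
  moreover have "of_int k * (2 * Re w) \<in> \<int>" "of_int (k\<^sup>2) * (cmod w)\<^sup>2 \<in> \<int>"
    using assms unfolding mem_ring_of_integers_iff by (blast intro: Ints_mult Ints_of_int)+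
  moreover have "of_int k * w \<in> K"
    using assms unfolding mem_ring_of_integers_iff by (auto simp: quadratic_field_def simp flip: times_divide_eq_right)
  ultimately show ?thesis by (simp only: mem_ring_of_integers_iff)
qed

lemma real_mem_ring_of_integers:
  assumes "z \<in> \<O>" "Im z = 0"
  obtains m :: int where "z = of_int m"
proof -
  have "Re z \<in> \<rat>" "algebraic_int (complex_of_real (Re z))"
    using assms complex_eq[of z] by (simp_all add: ring_of_integers_def quadratic_field_def)
  then have "Re z \<in> \<int>" by (intro rational_algebraic_int_is_int) (simp_all only: algebraic_int_of_real_iff)
  then obtain m where "Re z = of_int m" by (auto elim: Ints_cases)
  then show ?thesis using assms by (intro that[of m]) (simp add: complex_eq_iff)
qed

section \<open>Integral bases and the discriminant\<close>

lemma norm_form_integral: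
  assumes "z \<in> \<O>"
  shows "(2 * Im z)\<^sup>2 \<in> \<int>"
proof -
  have int: "2 * Re z \<in> \<int>" "(cmod z)\<^sup>2 \<in> \<int>" using assms by (simp_all add: mem_ring_of_integers_iff)
  have "(2 * Im z)\<^sup>2 = 4 * (cmod z)\<^sup>2 - (2 * Re z)\<^sup>2" by (simp add: cmod_power2 power_mult_distrib)
  also have "\<dots> \<in> \<int>"
    by (rule Ints_diff[OF Ints_mult[OF Ints_numeral int(2)] Ints_power[OF int(1)]])
  finally show ?thesis .
qed

lemma ex_nonreal_integer: "\<exists>z\<in>\<O>. Im z > 0"
proof -
  obtain d :: int where d: "d > 0" "of_int d * s\<^sup>2 \<in> \<int>"
    using common_denominator[of "{s\<^sup>2}"] s_square by auto
  let ?z = "\<i> * complex_of_real (of_int d * s)"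
  have "(cmod ?z)\<^sup>2 = of_int d * (of_int d * s\<^sup>2)"
    using d s_pos by (simp add: norm_mult power_mult_distrib power2_eq_square)
  then have "(cmod ?z)\<^sup>2 \<in> \<int>" using d by (metis Ints_mult Ints_of_int)
  then have "?z \<in> \<O>"
    using s_pos unfolding mem_ring_of_integers_iff by (auto simp: quadratic_field_def)
  moreover have "Im ?z > 0" using d s_pos by simp
  ultimately show ?thesis by blast
qed

text \<open>An integer of least positive imaginary part completes \<open>1\<close> to a basis: division with remainder of
  imaginary parts reduces every integer to a real one.\<close>

lemma ex_integral_basis: "\<exists>w. w \<in> \<O> \<and> Im w > 0 \<and> integral_basis K 1 w"
proof -
  \<comment> \<open>On \<open>\<O>\<close> the number \<open>(2 * Im z)\<^sup>2\<close> is a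
    nonnegative integer, so a least imaginary part exists by well-ordering.\<close>
  define f where "f = (\<lambda>z::complex. nat \<lfloor>(2 * Im z)\<^sup>2\<rfloor>)"
  obtain w where w: "w \<in> \<O>" "Im w > 0" and min: "\<And>z. z \<in> \<O> \<Longrightarrow> Im z > 0 \<Longrightarrow> f w \<le> f z"
    using exists_least_iff[of "\<lambda>n. \<exists>z\<in>\<O>. Im z > 0 \<and> f z = n"] ex_nonreal_integer
    by (metis linorder_not_less)
  have f: "real (f z) = (2 * Im z)\<^sup>2" if "z \<in> \<O>" for z
  proof -
    have "real (f z) = of_int \<lfloor>(2 * Im z)\<^sup>2\<rfloor>" unfolding f_def by (subst of_nat_nat) simp_all
    then show ?thesis using norm_form_integral[OF that] by (metis Ints_cases floor_of_int)
  qed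
  have "\<exists>m n. z = of_int m + of_int n * w" if z: "z \<in> \<O>" for z
  proof -
    define n where "n = \<lfloor>Im z / Im w\<rfloor>"
    define y where "y = z - of_int n * w"
    have y: "y \<in> \<O>" using z w by (simp add: y_def ring_of_integers_diff ring_of_integers_of_int_mult)
    have Imy: "Im y = Im z - of_int n * Im w" by (simp add: y_def)
    have "of_int n \<le> Im z / Im w" "Im z / Im w < of_int n + 1" unfolding n_def by linarith+
    then have "0 \<le> Im y" "Im y < Im w" using w(2) by (simp_all add: Imy field_simps)
    have "Im y = 0"
    proof (rule ccontr)
      assume "Im y \<noteq> 0"
      then have "f w \<le> f y" using \<open>0 \<le> Im y\<close> y by (intro min) auto
      then have "(2 * Im w)\<^sup>2 \<le> (2 * Im y)\<^sup>2" using f[OF y] f[OF w(1)] by (metis of_nat_le_iff)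
      then show False using \<open>0 \<le> Im y\<close> \<open>Im y < Im w\<close> by (simp add: power2_le_iff_abs_le)
    qed
    then obtain m where "y = of_int m" using y by (metis real_mem_ring_of_integers)
    then show ?thesis by (auto simp: y_def algebra_simps)
  qed
  moreover have "of_int m + of_int n * w \<in> \<O>" for m n
  proof -
    have "of_int m \<in> \<O>" unfolding mem_ring_of_integers_iff by (simp add: quadratic_field_def)
    from ring_of_integers_diff[OF this ring_of_integers_of_int_mult[OF w(1), of "- n"]]
    show ?thesis by simp
  qed
  ultimately have "range (\<lambda>(m::int, n::int). of_int m * 1 + of_int n * w) = \<O>"
    by (auto simp: image_iff)
  moreover have "inj (\<lambda>(m::int, n::int). of_int m * 1 + of_int n * w)"
    using w(2) by (auto simp: inj_on_def complex_eq_iff)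
  ultimately show ?thesis using w by (auto simp: integral_basis_def bij_betw_def)
qed

text \<open>Up to sign, \<open>Im (v1 * cnj v2)\<close> is the determinant of the pair
  \<open>v1\<close>, \<open>v2\<close> in the plane; passing to integral combinations multiplies it
  by an integral determinant. Used in both directions, this compares two integral bases.\<close>

lemma integral_basis_span:
  assumes u: "integral_basis K u1 u2" and v: "v1 \<in> \<O>" "v2 \<in> \<O>"
  shows "\<exists>k::int. Im (v1 * cnj v2) = of_int k * Im (u1 * cnj u2)"
proof -
  have "\<exists>m n :: int. v = of_int m * u1 + of_int n * u2" if "v \<in> \<O>" for v
    using u that by (fastforce simp: integral_basis_def bij_betw_def)
  then obtain m n m' n' :: int
    where "v1 = of_int m * u1 + of_int n * u2" "v2 = of_int m' * u1 + of_int n' * u2"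
    using v by metis
  then have "Im (v1 * cnj v2) = of_int (m * n' - n * m') * Im (u1 * cnj u2)"
    by (simp add: algebra_simps)
  then show ?thesis by blast
qed

lemma integral_basis_mem:
  assumes "integral_basis K u1 u2"
  shows "u1 \<in> \<O>" "u2 \<in> \<O>"
proof -
  have range: "of_int m * u1 + of_int n * u2 \<in> \<O>" for m n :: int
    using assms unfolding integral_basis_def bij_betw_def
    by (metis (mono_tags, lifting) case_prod_conv rangeI)
  from range[of 1 0] range[of 0 1] show "u1 \<in> \<O>" "u2 \<in> \<O>" by simp_all
qed

text \<open>\<open>field_disc\<close> is a definite description, so independence of the basis has to
  be shown: two integral bases have the same determinant up to sign. The basis \<open>1\<close>,
  \<open>w\<close> then gives \<open>- (2 * Im w)\<^sup>2\<close>, whence \<open>\<sigma>\<close> is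
  \<open>2 * Im w\<close>.\<close>

lemma sqrt_disc_quadratic_field:
  obtains \<sigma> where "\<sigma> > 0" "\<sigma> / s \<in> \<rat>" "\<sigma>\<^sup>2 \<in> \<int>" "sqrt_disc K = \<i> * complex_of_real \<sigma>"
proof -
  obtain w where w: "w \<in> \<O>" "Im w > 0" and basis: "integral_basis K 1 w"
    using ex_integral_basis by blast
  obtain d :: int where d: "(2 * Im w)\<^sup>2 = of_int d"
    using norm_form_integral[OF w(1)] by (auto elim: Ints_cases)
  have disc: "(w1 * cnj w2 - w2 * cnj w1)\<^sup>2 = complex_of_real (- (2 * Im (w1 * cnj w2))\<^sup>2)" for w1 w2
    by (simp add: complex_eq_iff power2_eq_square algebra_simps)
  have eq: "(Im (w1 * cnj w2))\<^sup>2 = (Im w)\<^sup>2" if b: "integral_basis K w1 w2" for w1 w2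
  proof -
    obtain k where k: "Im (w1 * cnj w2) = of_int k * Im (1 * cnj w)"
      using integral_basis_span[OF basis integral_basis_mem[OF b]] by blast
    obtain l where l: "Im (1 * cnj w) = of_int l * Im (w1 * cnj w2)"
      using integral_basis_span[OF b integral_basis_mem[OF basis]] by blast
    have "Im w = of_int (l * k) * Im w" using k l by simp
    then have "of_int (l * k) = (1 :: real)" using w(2) by simp
    then have "k * l = 1" by (metis of_int_eq_1_iff mult.commute)
    then have "k = 1 \<or> k = -1" unfolding zmult_eq_1_iff by blast
    then show ?thesis using k by (elim disjE) simp_all
  qed
  have "field_disc K = - d" unfolding field_disc_def
  proof (rule the_equality)
    have "complex_of_int (- d) = complex_of_real (- (2 * Im (1 * cnj w))\<^sup>2)"
      using d by simp
    then show "\<exists>w1 w2. integral_basis K w1 w2 \<and> of_int (- d) = (w1 * cnj w2 - w2 * cnj w1)\<^sup>2"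
      using basis disc by metis
  next
    fix D assume "\<exists>w1 w2. integral_basis K w1 w2 \<and> of_int D = (w1 * cnj w2 - w2 * cnj w1)\<^sup>2"
    then obtain w1 w2 where b: "integral_basis K w1 w2" and D: "of_int D = (w1 * cnj w2 - w2 * cnj w1)\<^sup>2"
      by blast
    have "complex_of_real (of_int D) = complex_of_real (- (2 * Im (w1 * cnj w2))\<^sup>2)"
      using D disc by (simp only: of_real_of_int_eq)
    then have "of_int D = - (2 * Im (w1 * cnj w2))\<^sup>2" by (simp only: of_real_eq_iff)
    also have "\<dots> = - (2 * Im w)\<^sup>2" using eq[OF b] by (simp only: power_mult_distrib)
    also have "\<dots> = of_int (- d)" using d by simp
    finally show "D = - d" by (simp only: of_int_eq_iff)
  qed
  moreover have "d \<ge> 0" using d by (metis of_int_0_le_iff zero_le_power2)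
  ultimately have "sqrt \<bar>of_int (field_disc K)\<bar> = sqrt ((2 * Im w)\<^sup>2)" using d by simp
  also have "\<dots> = 2 * Im w" using w(2) by (simp only: real_sqrt_abs)
  finally have "sqrt_disc K = \<i> * complex_of_real (2 * Im w)" by (simp only: sqrt_disc_def)
  moreover have "2 * Im w / s \<in> \<rat>"
    using w(1) unfolding mem_ring_of_integers_iff by (simp add: quadratic_field_def flip: times_divide_eq_right)
  ultimately show ?thesis using w(2) norm_form_integral[OF w(1)] by (intro that[of "2 * Im w"]) simp_all
qed

end

section \<open>The action on Minkowski space\<close>

definition cvec :: "oriented_circle \<Rightarrow> real ^ 4" where
  "cvec C = vector [Re (ccenter C), Im (ccenter C), cocurv C, curv C]"

definition of_cvec :: "real ^ 4 \<Rightarrow> oriented_circle" where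
  "of_cvec x = \<lparr>ccenter = Complex (x $ 1) (x $ 2), cocurv = x $ 3, curv = x $ 4\<rparr>"

definition act :: "complex ^ 2 ^ 2 \<Rightarrow> real ^ 4 \<Rightarrow> real ^ 4" where
  "act A x = cvec (circle_act A (of_cvec x))"

text \<open>The polarization of the quadratic form in the definition of oriented circles, of
  signature (3,1); the circles are the vectors of norm 1.\<close>

definition mink :: "real ^ 4 \<Rightarrow> real ^ 4 \<Rightarrow> real" where
  "mink x y = x $ 1 * y $ 1 + x $ 2 * y $ 2 - (x $ 3 * y $ 4 + x $ 4 * y $ 3) / 2"

definition mink_matrix :: "real ^ 4 ^ 4" where
  "mink_matrix = vector [vector [1, 0, 0, 0], vector [0, 1, 0, 0],
     vector [0, 0, 0, - 1 / 2], vector [0, 0, - 1 / 2, 0]]"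

lemma cvec_nth [simp]:
  "cvec C $ 1 = Re (ccenter C)" "cvec C $ 2 = Im (ccenter C)" "cvec C $ 3 = cocurv C" "cvec C $ 4 = curv C"
  by (simp_all add: cvec_def)

lemma of_cvec_sel [simp]:
  "ccenter (of_cvec x) = Complex (x $ 1) (x $ 2)" "cocurv (of_cvec x) = x $ 3" "curv (of_cvec x) = x $ 4"
  by (simp_all add: of_cvec_def)

lemma cvec_of_cvec [simp]: "cvec (of_cvec x) = x"
  by (simp add: vec_eq_iff forall_4)

lemma of_cvec_cvec [simp]: "of_cvec (cvec C) = C"
  by (simp add: of_cvec_def)

lemma act_cvec: "act A (cvec C) = cvec (circle_act A C)"
  by (simp add: act_def)

lemma linear_act: "linear (act A)"
  by (rule linearI) (simp_all add: act_def vec_eq_iff forall_4 circle_act_simps algebra_simps)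

lemma circle_act_mult: "circle_act A (circle_act B C) = circle_act (A ** B) C"
proof (rule oriented_circle.equality)
  show "ccenter (circle_act A (circle_act B C)) = ccenter (circle_act (A ** B) C)"
    unfolding circle_act_simps matrix_matrix_mult_def
    by (simp add: sum_2 complex_eq_iff cmod_power2, algebra)
qed (unfold circle_act_simps matrix_matrix_mult_def,
    simp_all add: sum_2 cmod_power2, algebra+)

lemma mink_self_cvec: "mink (cvec C) (cvec C) = (cmod (ccenter C))\<^sup>2 - curv C * cocurv C"
  unfolding cmod_power2 by (simp add: mink_def power2_eq_square)

lemma mink_self_act:
  assumes "det A = 1"
  shows "mink (act A x) (act A x) = mink x x"
proof -
  have "mink (act A x) (act A x) = (cmod (det A))\<^sup>2 * mink x x"
    unfolding mink_def act_def cvec_nth circle_act_simps det_2 cmod_power2 by (simp, algebra)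
  then show ?thesis using assms by simp
qed

lemma mink_matrix: "x \<bullet> (mink_matrix *v y) = mink x y"
  by (simp add: mink_matrix_def mink_def matrix_vector_mult_def inner_vec_def sum_4 algebra_simps)

lemma bilinear_mink: "bilinear mink"
  unfolding bilinear_def linear_iff by (simp add: mink_def algebra_simps add_divide_distrib)

lemma mink_act:
  assumes "det A = 1"
  shows "mink (act A x) (act A y) = mink x y"
proof -
  have pol: "mink u v = (mink (u + v) (u + v) - mink u u - mink v v) / 2" for u v
    by (simp add: mink_def field_simps)
  show ?thesis
    using pol[of "act A x" "act A y"] pol[of x y]
    by (simp only: linear_add[OF linear_act, symmetric] mink_self_act[OF assms])
qed

text \<open>This makes Zariski density applicable to conditions on the action.\<close>

lemma real_polynomial_function_act: "real_polynomial_function (\<lambda>A. act A x $ i)"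
proof -
  have reim: "real_polynomial_function (\<lambda>A::complex^2^2. Re (A $ i $ j))"
    "real_polynomial_function (\<lambda>A::complex^2^2. Im (A $ i $ j))" for i j
    by (auto intro!: real_polynomial_function.intros(1) bounded_linear_compose[OF bounded_linear_Re]
        bounded_linear_compose[OF bounded_linear_Im] bounded_linear_compose[OF bounded_linear_vec_nth]
        bounded_linear_vec_nth)
  have "i \<in> {1, 2, 3, 4}" using exhaust_4[of i] by auto
  then show ?thesis
    by (elim insertE emptyE; simp add: act_def circle_act_simps cmod_power2;
        intro real_polynomial_function.intros(2-4) real_polynomial_function_diff
          real_polynomial_function_power reim)
qed

text \<open>Three matrices suffice. \<open>D\<close> scales the coordinates by 1, 1, 4, 1/4 and so
  kills each entry of \<open>S\<close> whose two weights do not multiply to 1; the translations by 1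
  and \<open>\<i>\<close> relate the remaining entries.\<close>

lemma invariant_matrix_eq:
  assumes inv: "\<And>A x y. det A = 1 \<Longrightarrow> act A x \<bullet> (S *v act A y) = x \<bullet> (S *v y)"
  shows "S = S $ 1 $ 1 *\<^sub>R mink_matrix"
proof -
  define D :: "complex^2^2" where "D = vector [vector [2, 0], vector [0, 1 / 2]]"
  define T :: "complex \<Rightarrow> complex^2^2" where "T = (\<lambda>b. vector [vector [1, b], vector [0, 1]])"
  have det: "det D = 1" "det (T b) = 1" for b by (simp_all add: D_def T_def det_2)
  have entry: "axis i 1 \<bullet> (S *v axis j 1) = S $ i $ j" for i j
    by (simp add: matrix_vector_mult_basis column_def inner_axis')
  have D: "act D x = vector [x $ 1, x $ 2, 4 * x $ 3, x $ 4 / 4]" for x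
    by (simp add: vec_eq_iff forall_4 act_def circle_act_simps D_def norm_divide power2_eq_square)
  have T1: "act (T 1) x = vector [x $ 1 + x $ 4, x $ 2, x $ 3 + 2 * x $ 1 + x $ 4, x $ 4]" for x
    by (simp add: vec_eq_iff forall_4 act_def circle_act_simps T_def)
  have Ti: "act (T \<i>) x = vector [x $ 1, x $ 2 + x $ 4, x $ 3 + 2 * x $ 2 + x $ 4, x $ 4]" for x
    by (simp add: vec_eq_iff forall_4 act_def circle_act_simps T_def)
  note expand = matrix_vector_mult_def inner_vec_def sum_4 axis_def
  note d = inv[OF det(1), of "axis i 1" "axis j 1" for i j, unfolded entry D]
  note t1 = inv[OF det(2)[of 1], of "axis i 1" "axis j 1" for i j, unfolded entry T1]
  note ti = inv[OF det(2)[of \<i>], of "axis i 1" "axis j 1" for i j, unfolded entry Ti]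
  have z: "S $ 1 $ 3 = 0" "S $ 1 $ 4 = 0" "S $ 2 $ 3 = 0" "S $ 2 $ 4 = 0" "S $ 3 $ 3 = 0" "S $ 4 $ 4 = 0"
    "S $ 3 $ 1 = 0" "S $ 4 $ 1 = 0" "S $ 3 $ 2 = 0" "S $ 4 $ 2 = 0"
    using d[of 1 3] d[of 1 4] d[of 2 3] d[of 2 4] d[of 3 3] d[of 4 4]
      d[of 3 1] d[of 4 1] d[of 3 2] d[of 4 2]
    by (simp_all add: expand)
  have "S $ 1 $ 1 + 2 * S $ 3 $ 4 = 0" "S $ 2 $ 1 = 0" "S $ 1 $ 1 + 2 * S $ 4 $ 3 = 0"
    using t1[of 1 4] t1[of 2 4] t1[of 4 1] z by (simp_all add: expand)
  moreover have "S $ 2 $ 2 + 2 * S $ 3 $ 4 = 0" "S $ 1 $ 2 = 0"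
    using ti[of 2 4] ti[of 1 4] z by (simp_all add: expand)
  ultimately show ?thesis
    using z by (simp add: vec_eq_iff forall_4 mink_matrix_def)
qed

text \<open>The curvatures after the identity and after \<open>z \<mapsto> -1 / (z + b)\<close> with
  \<open>b\<close> = 0, 1, \<open>\<i>\<close> determine all four coordinates of
  \<open>x\<close>.\<close>

lemma ex_curv_act_nonzero:
  assumes "x \<noteq> 0"
  shows "\<exists>A. det A = 1 \<and> act A x $ 4 \<noteq> 0"
proof (rule ccontr)
  assume *: "\<not> ?thesis"
  define B :: "complex \<Rightarrow> complex^2^2" where "B = (\<lambda>b. vector [vector [0, -1], vector [1, b]])"
  have "det (mat 1 :: complex^2^2) = 1" "det (B b) = 1" for b by (simp, simp add: B_def det_2)
  then have "act (mat 1) x $ 4 = 0" "act (B b) x $ 4 = 0" for b using * by blast+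
  note 0 = this(1) this(2)[of 0] this(2)[of 1] this(2)[of \<i>]
  then have "x $ 4 = 0" "x $ 3 = 0" "x $ 1 = 0" "x $ 2 = 0"
    by (simp_all add: act_def circle_act_simps B_def mat_def)
  then show False using assms by (simp add: vec_eq_iff forall_4)
qed

lemma act_act: "act A (act B x) = act (A ** B) x"
  by (simp add: act_def circle_act_mult)

text \<open>The orbit of a nonzero vector spans the space. Once \<open>x\<close> is moved to
  \<open>u\<close> with nonzero curvature, translations suffice: the second difference in
  \<open>b\<close> isolates \<open>f $ 3 * u $ 4\<close>, the first differences then
  \<open>f $ 1 * u $ 4\<close> and \<open>f $ 2 * u $ 4\<close>, and \<open>f $ 4\<close> is
  left.\<close>

lemma ex_inner_act_nonzero:
  assumes "x \<noteq> 0" "f \<noteq> 0"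
  shows "\<exists>A. det A = 1 \<and> f \<bullet> act A x \<noteq> 0"
proof (rule ccontr)
  assume *: "\<not> ?thesis"
  obtain A where A: "det A = 1" "act A x $ 4 \<noteq> 0" using ex_curv_act_nonzero[OF assms(1)] by blast
  define u where "u = act A x"
  define T :: "complex \<Rightarrow> complex^2^2" where "T = (\<lambda>b. vector [vector [1, b], vector [0, 1]])"
  have "det (T b) = 1" for b by (simp add: T_def det_2)
  then have "det (T b ** A) = 1" for b using A by (simp add: det_mul)
  then have "f \<bullet> act (T b) u = 0" for b using * unfolding u_def act_act by blast
  note 0 = this[of 0] this[of 1] this[of "-1"] this[of \<i>] this[of "- \<i>"]
  have u: "u $ 4 \<noteq> 0" using A by (simp add: u_def)
  have e: "f \<bullet> act (T 0) u = f $ 1 * u $ 1 + f $ 2 * u $ 2 + f $ 3 * u $ 3 + f $ 4 * u $ 4"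
    "f \<bullet> act (T 1) u = f $ 1 * (u $ 1 + u $ 4) + f $ 2 * u $ 2 + f $ 3 * (u $ 3 + 2 * u $ 1 + u $ 4) + f $ 4 * u $ 4"
    "f \<bullet> act (T (-1)) u = f $ 1 * (u $ 1 - u $ 4) + f $ 2 * u $ 2 + f $ 3 * (u $ 3 - 2 * u $ 1 + u $ 4) + f $ 4 * u $ 4"
    "f \<bullet> act (T \<i>) u = f $ 1 * u $ 1 + f $ 2 * (u $ 2 + u $ 4) + f $ 3 * (u $ 3 + 2 * u $ 2 + u $ 4) + f $ 4 * u $ 4"
    "f \<bullet> act (T (-\<i>)) u = f $ 1 * u $ 1 + f $ 2 * (u $ 2 - u $ 4) + f $ 3 * (u $ 3 - 2 * u $ 2 + u $ 4) + f $ 4 * u $ 4"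
    by (simp_all add: inner_vec_def sum_4 act_def circle_act_simps T_def algebra_simps)
  note 1 = 0[unfolded e]
  have "f $ 3 * u $ 4 = 0" using 1(1-3) by algebra
  then have f3: "f $ 3 = 0" using u by simp
  have "f $ 1 * u $ 4 = 0" "f $ 2 * u $ 4 = 0" using 1 f3 by (simp_all add: algebra_simps)
  then have f12: "f $ 1 = 0" "f $ 2 = 0" using u by simp_all
  then have "f $ 4 = 0" using 1(1) f3 u by simp
  then show False using f12 f3 assms(2) by (simp add: vec_eq_iff forall_4)
qed

section \<open>Rationality of the Minkowski form\<close>

lemma det_Ints:
  fixes A :: "'a::comm_ring_1 ^ 'n ^ 'n"
  assumes "\<And>i j. A $ i $ j \<in> \<int>"
  shows "det A \<in> \<int>"
  unfolding det_def using assms by (intro Ints_sum Ints_mult Ints_prod Ints_of_int) auto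

lemma vector_matrix_mult_sum_rows: "y v* X = (\<Sum>i\<in>UNIV. y $ i *\<^sub>R X $ i)"
  for X :: "real ^ 'n ^ 'm"
  by (simp add: vec_eq_iff vector_matrix_mult_def mult.commute)

text \<open>Such a set lies in no hyperplane through 0, so it spans, and a basis chosen from it
  provides the rows.\<close>

lemma ex_invertible_rows:
  fixes S :: "(real ^ 'n) set"
  assumes "\<And>x. x \<noteq> 0 \<Longrightarrow> \<exists>s\<in>S. s \<bullet> x \<noteq> 0"
  shows "\<exists>X :: real ^ 'n ^ 'n. (\<forall>i. X $ i \<in> S) \<and> det X \<noteq> 0"
proof -
  have span: "span S = UNIV"
  proof (rule ccontr)
    assume "span S \<noteq> UNIV"
    then obtain a where "a \<noteq> 0" "span S \<subseteq> {x. a \<bullet> x = 0}"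
      using span_not_univ_subset_hyperplane by blast
    then show False using assms[of a] span_base[of _ S] by (auto simp: inner_commute)
  qed
  obtain B where B: "B \<subseteq> S" "independent B" "S \<subseteq> span B"
    using maximal_independent_subset[of S] by blast
  have spanB: "span B = UNIV" using B(3) span span_mono[of S "span B"] by (auto simp: span_span)
  have "card B = CARD('n)"
    using dim_eq_card[of B UNIV] B(2) spanB by simp
  moreover have "finite B" using B(2) by (rule finiteI_independent)
  ultimately obtain f :: "'n \<Rightarrow> real ^ 'n" where f: "bij_betw f UNIV B"
    using finite_same_card_bij[of "UNIV :: 'n set" B] by auto
  let ?X = "\<chi> i. f i"
  have "rows ?X = B" using f by (auto simp: rows_def row_def bij_betw_def)
  then have "\<exists>Y. Y ** ?X = mat 1" using spanB by (simp add: matrix_left_invertible_span_rows)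
  then have "det ?X \<noteq> 0" by (metis invertible_det_nz invertible_left_inverse)
  moreover have "?X $ i \<in> S" for i using f B(1) by (auto simp: bij_betw_def)
  ultimately show ?thesis by blast
qed

text \<open>The independent set \<open>{1}\<close> extends to a basis of the reals over the
  rationals, which allows a rational-valued linear functional to be prescribed at 1.\<close>

lemma ex_rational_retraction:
  "\<exists>\<phi>::real \<Rightarrow> real. (\<forall>x y. \<phi> (x + y) = \<phi> x + \<phi> y) \<and> (\<forall>q\<in>\<rat>. \<forall>x. \<phi> (q * x) = q * \<phi> x) \<and>
     (\<forall>x. \<phi> x \<in> \<rat>) \<and> \<phi> 1 = 1"
proof -
  interpret p: vector_space_pair "\<lambda>(q::rat) (x::real). of_rat q * x" "(*) :: rat \<Rightarrow> rat \<Rightarrow> rat"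
    by unfold_locales (simp_all add: algebra_simps of_rat_add of_rat_mult)
  have "p.vs1.independent {1}"
    by (subst p.vs1.independent_insert) (auto simp: p.vs1.independent_empty)
  then obtain f where f: "Vector_Spaces.linear (\<lambda>q x. of_rat q * x) (*) f" "f (1::real) = (1::rat)"
    using p.linear_independent_extend[of "{1}" "\<lambda>_. 1"] by auto
  interpret l: Vector_Spaces.linear "\<lambda>(q::rat) (x::real). of_rat q * x" "(*) :: rat \<Rightarrow> rat \<Rightarrow> rat" f
    by (rule f(1))
  show ?thesis
  proof (intro exI[of _ "\<lambda>x. of_rat (f x)"] conjI allI ballI)
    fix q x :: real assume "q \<in> \<rat>"
    then show "of_rat (f (q * x)) = q * of_rat (f x)"
      by (auto simp: l.scale of_rat_mult elim!: Rats_cases)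
  qed (simp_all add: l.add of_rat_add f(2))
qed

text \<open>\<open>G\<close> stands for the preimage of \<open>\<Gamma>\<close> in
  \<open>SL2C\<close>, so that invariance and density can be used on matrices without choosing
  representatives.\<close>

locale integral_orbit =
  fixes \<A> :: "oriented_circle set" and G :: "(complex ^ 2 ^ 2) set" and l :: real
  assumes circles: "\<A> \<subseteq> oriented_circles" and nonempty: "\<A> \<noteq> {}"
    and integral: "C \<in> \<A> \<Longrightarrow> l * curv C \<in> \<int>" and l_pos: "l > 0"
    and invariant: "A \<in> G \<Longrightarrow> C \<in> \<A> \<Longrightarrow> circle_act A C \<in> \<A>"
    and det: "A \<in> G \<Longrightarrow> det A = 1"
    and dense: "real_polynomial_function p \<Longrightarrow> (\<And>A. A \<in> G \<Longrightarrow> p A = 0) \<Longrightarrow> det B = 1 \<Longrightarrow> p B = 0"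
begin

section \<open>The lattice containing the arrangement\<close>

lemma mink_self: "C \<in> \<A> \<Longrightarrow> mink (cvec C) (cvec C) = 1"
  using circles by (auto simp: mink_self_cvec oriented_circles_def)

text \<open>The circles span the space: for one circle \<open>C\<close> the polynomial
  \<open>f \<bullet> act A (cvec C)\<close> in \<open>A\<close> is nonzero somewhere on
  \<open>SL2C\<close>, hence by density at some element of \<open>G\<close>, which moves
  \<open>C\<close> within \<open>\<A>\<close>.\<close>

lemma ex_inner_cvec_nonzero:
  assumes "f \<noteq> 0"
  shows "\<exists>C\<in>\<A>. cvec C \<bullet> f \<noteq> 0"
proof -
  obtain C where C: "C \<in> \<A>" using nonempty by blast
  have "cvec C \<noteq> 0"
  proof
    assume "cvec C = 0"
    then show False using mink_self[OF C] by (simp add: mink_def del: cvec_nth)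
  qed
  then obtain A where A: "det A = 1" "f \<bullet> act A (cvec C) \<noteq> 0"
    using ex_inner_act_nonzero assms by blast
  have "real_polynomial_function (\<lambda>A. f \<bullet> act A (cvec C))"
    unfolding inner_vec_def inner_real_def
    by (intro real_polynomial_function_sum real_polynomial_function.intros real_polynomial_function_act finite)
  then obtain B where "B \<in> G" "f \<bullet> act B (cvec C) \<noteq> 0" using dense A by blast
  then show ?thesis using invariant C by (metis act_cvec inner_commute)
qed

lemma ex_linear_cvec_nonzero:
  assumes "linear (f :: real ^ 4 \<Rightarrow> real)" "f x \<noteq> 0"
  shows "\<exists>C\<in>\<A>. f (cvec C) \<noteq> 0"
proof -
  obtain v where v: "\<And>y. f y = v \<bullet> y"
    using assms(1) by (metis adjoint_works inner_real_def mult.left_neutral inner_commute)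
  then have "v \<noteq> 0" using assms(2) by auto
  then show ?thesis using ex_inner_cvec_nonzero v by (metis inner_commute)
qed

lemma ex_curv_orbit_nonzero:
  assumes "x \<noteq> 0"
  shows "\<exists>A\<in>G. act A x $ 4 \<noteq> 0"
  using ex_curv_act_nonzero[OF assms] dense[OF real_polynomial_function_act] by blast

text \<open>The curvatures of four suitable translates of a circle determine it by integral data; Cramer's
  rule then bounds the denominators.\<close>

lemma ex_lattice:
  obtains X :: "real ^ 4 ^ 4" and N :: int
  where "det X \<noteq> 0" "N > 0" "\<And>i. X $ i \<in> cvec ` \<A>"
    "\<And>C. C \<in> \<A> \<Longrightarrow> \<exists>y. cvec C = y v* X \<and> (\<forall>i. of_int N * y $ i \<in> \<int>)"
proof -
  let ?R = "\<lambda>A. matrix (act A)"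
  have R: "?R A *v x = act A x" for A x
    by (rule matrix_works) (use linear_act in \<open>simp add: linear_matrix_vector_mul_eq\<close>)
  have R4: "?R A $ 4 \<bullet> x = act A x $ 4" for A x
    by (simp flip: R add: matrix_mult_dot)
  have "\<exists>s\<in>(\<lambda>A. l *\<^sub>R ?R A $ 4) ` G. s \<bullet> x \<noteq> 0" if "x \<noteq> 0" for x
    using ex_curv_orbit_nonzero[OF that] l_pos by (auto simp: R4)
  \<comment> \<open>Four translates of the curvature functional that form a basis of the dual space;
    the factor \<open>l\<close> makes them integral on \<open>\<A>\<close>.\<close>
  then obtain L where L: "\<And>i. L $ i \<in> (\<lambda>A. l *\<^sub>R ?R A $ 4) ` G" "det L \<noteq> 0"
    using ex_invertible_rows by metis
  obtain X where X: "\<And>i. X $ i \<in> cvec ` \<A>" "det X \<noteq> 0"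
    using ex_invertible_rows[of "cvec ` \<A>"] ex_inner_cvec_nonzero by auto
  have int: "L $ i \<bullet> cvec C \<in> \<int>" if "C \<in> \<A>" for i C
  proof -
    obtain A where "A \<in> G" "L $ i = l *\<^sub>R ?R A $ 4" using L(1)[of i] by blast
    then have "L $ i \<bullet> cvec C = l * curv (circle_act A C)" by (simp add: R4 act_cvec)
    then show ?thesis using integral invariant \<open>A \<in> G\<close> that by simp
  qed
  \<comment> \<open>The values of the four functionals at the four basis circles. This matrix is
    integral, and its determinant serves as the common denominator of all coordinates.\<close>
  let ?M = "L ** transpose X"
  have "?M $ i $ j = L $ i \<bullet> X $ j" for i j
    by (simp add: matrix_matrix_mult_def transpose_def inner_vec_def)
  then have M: "?M $ i $ j \<in> \<int>" for i j using int X(1)[of j] by auto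
  then obtain n where n: "det ?M = of_int n" using det_Ints[of ?M] by (auto elim: Ints_cases)
  have M0: "det ?M \<noteq> 0" using L(2) X(2) by (simp add: det_mul)
  then have n0: "n \<noteq> 0" using n by auto
  show ?thesis
  proof (rule that[of X "\<bar>n\<bar>"])
    fix C assume C: "C \<in> \<A>"
    obtain Y where Y: "Y ** X = mat 1" using X(2) by (metis invertible_det_nz invertible_left_inverse)
    define y where "y = cvec C v* Y"
    have y: "cvec C = y v* X" by (simp add: y_def vector_matrix_mul_assoc Y)
    define b where "b = L *v cvec C"
    have b: "b $ i \<in> \<int>" for i using int[OF C] by (simp add: b_def matrix_mult_dot)
    have "?M *v y = b" by (simp add: b_def y flip: matrix_vector_mul_assoc)
    then have "y = (\<chi> k. det (\<chi> i j. if j = k then b $ i else ?M $ i $ j) / det ?M)"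
      using cramer[OF M0] by blast
    then have "of_int n * y $ k = det (\<chi> i j. if j = k then b $ i else ?M $ i $ j)" for k
      using n0 unfolding n by (simp add: vec_eq_iff)
    moreover have "det (\<chi> i j. if j = k then b $ i else ?M $ i $ j) \<in> \<int>" for k
      using b M by (intro det_Ints) simp
    ultimately have "of_int n * y $ k \<in> \<int>" for k by simp
    then have "of_int \<bar>n\<bar> * y $ k \<in> \<int>" for k
      by (cases "n \<ge> 0") (auto simp: abs_if)
    then show "\<exists>y. cvec C = y v* X \<and> (\<forall>i. of_int \<bar>n\<bar> * y $ i \<in> \<int>)" using y by blast
  qed (use n0 X in auto)
qed

text \<open>The four values of \<open>f\<close> on a basis from \<open>\<A>\<close> have a common
  denominator \<open>d\<close>, and the coordinates of all circles have the common denominator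
  \<open>N\<close>, so \<open>N * d\<close> works throughout.\<close>

lemma linear_bounded_denominators:
  assumes f: "linear (f :: real ^ 4 \<Rightarrow> real)" and rat: "\<And>C. C \<in> \<A> \<Longrightarrow> f (cvec C) \<in> \<rat>"
  shows "\<exists>d::int. d > 0 \<and> (\<forall>C\<in>\<A>. of_int d * f (cvec C) \<in> \<int>)"
proof -
  obtain X N where "det X \<noteq> 0" and N: "N > 0" and X: "\<And>i. X $ i \<in> cvec ` \<A>"
    and lat: "\<And>C. C \<in> \<A> \<Longrightarrow> \<exists>y. cvec C = y v* X \<and> (\<forall>i. of_int N * y $ i \<in> \<int>)"
    by (rule ex_lattice) (rule that)
  have "f (X $ i) \<in> \<rat>" for i using X[of i] rat by auto
  then have "\<exists>d::int. d > 0 \<and> (\<forall>x\<in>range (\<lambda>i. f (X $ i)). of_int d * x \<in> \<int>)"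
    by (intro common_denominator) auto
  then obtain d :: int where d: "d > 0" "\<And>i. of_int d * f (X $ i) \<in> \<int>" by auto
  show ?thesis
  proof (intro exI[of _ "N * d"] conjI ballI)
    show "N * d > 0" using N d by simp
    fix C assume "C \<in> \<A>"
    then obtain y where y: "cvec C = y v* X" "\<And>i. of_int N * y $ i \<in> \<int>" using lat by blast
    have "of_int (N * d) * f (cvec C) = (\<Sum>i\<in>UNIV. (of_int N * y $ i) * (of_int d * f (X $ i)))"
      unfolding y(1) vector_matrix_mult_sum_rows
      by (simp add: linear_sum[OF f] linear_scale[OF f] sum_distrib_left mult_ac)
    also have "\<dots> \<in> \<int>" using Ints_mult[OF y(2) d(2)] by (intro Ints_sum)
    finally show "of_int (N * d) * f (cvec C) \<in> \<int>" .
  qed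
qed

text \<open>The Gram matrix of a basis taken from \<open>\<A>\<close> is fixed by matrices with rational entries, so applying
  a \<open>\<rat>\<close>-linear retraction \<open>\<real> \<rightarrow> \<rat>\<close> to its entries gives another invariant form. By density this
  is a multiple of the Minkowski form, and comparing the values at a circle the factor is \<open>1\<close>.\<close>

lemma mink_rational:
  assumes "C \<in> \<A>" "C' \<in> \<A>"
  shows "mink (cvec C) (cvec C') \<in> \<rat>"
proof -
  obtain X N where X0: "det X \<noteq> 0" and N: "N > 0" and X: "\<And>i. X $ i \<in> cvec ` \<A>"
    and lat: "\<And>C. C \<in> \<A> \<Longrightarrow> \<exists>y. cvec C = y v* X \<and> (\<forall>i. of_int N * y $ i \<in> \<int>)"
    by (rule ex_lattice) (rule that)
  have coord: "\<exists>y. cvec C = y v* X \<and> (\<forall>i. y $ i \<in> \<rat>)" if "C \<in> \<A>" for C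
  proof -
    obtain y where y: "cvec C = y v* X" "\<And>i. of_int N * y $ i \<in> \<int>" using lat[OF \<open>C \<in> \<A>\<close>] by blast
    have "y $ i \<in> \<rat>" for i
    proof -
      have "of_int N * y $ i \<in> \<rat>" using y(2) Ints_subset_Rats by blast
      then have "(of_int N * y $ i) / of_int N \<in> \<rat>" by (intro Rats_divide) auto
      then show ?thesis using N by simp
    qed
    then show ?thesis using y by blast
  qed
  obtain \<phi> :: "real \<Rightarrow> real" where add: "\<And>x y. \<phi> (x + y) = \<phi> x + \<phi> y"
    and scale: "\<And>q x. q \<in> \<rat> \<Longrightarrow> \<phi> (q * x) = q * \<phi> x"
    and rat: "\<And>x. \<phi> x \<in> \<rat>" and one: "\<phi> 1 = 1"
    using ex_rational_retraction by metis
  have zero: "\<phi> 0 = 0" using add[of 0 0] by simp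
  have sum: "\<phi> (sum f I) = (\<Sum>i\<in>I. \<phi> (f i))" if "finite I" for f :: "4 \<Rightarrow> real" and I
    using that by (induction rule: finite_induct) (simp_all add: zero add)
  \<comment> \<open>Applied entrywise, the rational-linear \<open>\<phi>\<close> commutes with
    multiplication by rational matrices from either side.\<close>
  define \<Phi> :: "real^4^4 \<Rightarrow> real^4^4" where "\<Phi> = (\<lambda>M. \<chi> i j. \<phi> (M $ i $ j))"
  have \<Phi>_left: "\<Phi> (g ** M) = g ** \<Phi> M" if "\<And>i j. g $ i $ j \<in> \<rat>" for g M
    using that by (simp add: \<Phi>_def matrix_matrix_mult_def vec_eq_iff sum scale)
  have \<Phi>_right: "\<Phi> (M ** transpose g) = \<Phi> M ** transpose g" if "\<And>i j. g $ i $ j \<in> \<rat>" for g M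
    using that by (simp add: \<Phi>_def matrix_matrix_mult_def vec_eq_iff sum scale transpose_def mult.commute[of _ "g $ _ $ _"])
  let ?J = mink_matrix
  define Gr where "Gr = X ** ?J ** transpose X"
  have Gr: "Gr $ i $ j = mink (X $ i) (X $ j)" for i j
    by (simp add: Gr_def mink_def mink_matrix_def matrix_matrix_mult_def transpose_def sum_4 algebra_simps)
  obtain Y where Y: "Y ** X = mat 1" "X ** Y = mat 1"
    using X0 by (metis invertible_det_nz invertible_def)
  have TY: "transpose X ** transpose Y = mat 1" "transpose Y ** transpose X = mat 1"
    using Y by (simp_all flip: matrix_transpose_mul)
  \<comment> \<open>The form whose Gram matrix in the basis \<open>X\<close> is
    \<open>\<Phi> Gr\<close>, expressed in standard coordinates.\<close>
  define S where "S = Y ** \<Phi> Gr ** transpose Y"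
  have XSX: "X ** S ** transpose X = \<Phi> Gr"
    unfolding S_def by (metis Y(2) TY(2) matrix_mul_assoc matrix_mul_lid matrix_mul_rid)
  let ?R = "\<lambda>A. matrix (act A)"
  have R: "?R A *v x = act A x" for A x
    by (rule matrix_works) (use linear_act in \<open>simp add: linear_matrix_vector_mul_eq\<close>)
  have form: "x \<bullet> ((transpose (?R A) ** M ** ?R A) *v y) = act A x \<bullet> (M *v act A y)" for A M x y
  proof -
    have "(transpose (?R A) ** M ** ?R A) *v y = (M *v act A y) v* ?R A"
      by (simp add: R flip: matrix_vector_mul_assoc)
    then have "x \<bullet> ((transpose (?R A) ** M ** ?R A) *v y) = ((M *v act A y) v* ?R A) \<bullet> x"
      by (simp only: inner_commute)
    also have "\<dots> = (M *v act A y) \<bullet> act A x" by (simp only: dot_lmul_matrix R)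
    finally show ?thesis by (simp only: inner_commute)
  qed
  have RJ: "transpose (?R A) ** ?J ** ?R A = ?J" if "det A = 1" for A
  proof -
    have "x \<bullet> ((transpose (?R A) ** ?J ** ?R A) *v y) = x \<bullet> (?J *v y)" for x y
      by (simp only: form mink_matrix mink_act[OF that])
    then show ?thesis by (metis matrix_eq vector_eq_rdot inner_commute)
  qed
  have RS: "transpose (?R A) ** S ** ?R A = S" if "A \<in> G" for A
  proof -
    have "\<exists>y. act A (X $ i) = y v* X \<and> (\<forall>j. y $ j \<in> \<rat>)" for i
    proof -
      obtain C where "C \<in> \<A>" "X $ i = cvec C" using X[of i] by blast
      then show ?thesis using coord invariant[OF that] by (simp add: act_cvec)
    qed
    then obtain f where f: "\<And>i. act A (X $ i) = f i v* X" "\<And>i j. f i $ j \<in> \<rat>" by metis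
    \<comment> \<open>The matrix of \<open>A\<close> in the basis \<open>X\<close>. It is rational
      because \<open>A\<close> sends the basis circles to circles of \<open>\<A>\<close>, whose
      coordinates are rational.\<close>
    define g where "g = (\<chi> i. f i)"
    have g: "g $ i $ j \<in> \<rat>" for i j using f(2) by (simp add: g_def)
    have gX: "X ** transpose (?R A) = g ** X"
    proof -
      have "(X ** transpose (?R A)) $ i = ?R A *v X $ i" "(g ** X) $ i = f i v* X" for i
        by (simp_all add: g_def vec_eq_iff matrix_matrix_mult_def matrix_vector_mult_def
            vector_matrix_mult_def transpose_def mult.commute)
      then show ?thesis by (simp add: vec_eq_iff[of "X ** _"] R f(1))
    qed
    have conj: "g ** (X ** M ** transpose X) ** transpose g = X ** (transpose (?R A) ** M ** ?R A) ** transpose X" for M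
    proof -
      have "g ** (X ** M ** transpose X) ** transpose g = (g ** X) ** M ** transpose (g ** X)"
        by (simp only: matrix_transpose_mul matrix_mul_assoc)
      then show ?thesis
        by (simp only: gX[symmetric] matrix_transpose_mul transpose_transpose matrix_mul_assoc)
    qed
    have "g ** Gr ** transpose g = Gr"
      unfolding Gr_def conj RJ[OF det[OF that]] ..
    then have "g ** \<Phi> Gr ** transpose g = \<Phi> Gr"
      by (metis \<Phi>_left[OF g] \<Phi>_right[OF g])
    then have "X ** (transpose (?R A) ** S ** ?R A) ** transpose X = X ** S ** transpose X"
      unfolding XSX[symmetric] conj .
    then have "Y ** (X ** (transpose (?R A) ** S ** ?R A) ** transpose X) ** transpose Y
        = Y ** (X ** S ** transpose X) ** transpose Y" by simp
    moreover have "Y ** (X ** M ** transpose X) ** transpose Y = M" for M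
    proof -
      have "Y ** (X ** M ** transpose X) ** transpose Y = (Y ** X) ** M ** (transpose X ** transpose Y)"
        by (simp only: matrix_mul_assoc)
      then show ?thesis by (simp add: Y TY)
    qed
    ultimately show ?thesis by simp
  qed
  have inv: "act A x \<bullet> (S *v act A y) = x \<bullet> (S *v y)" if "det A = 1" for A x y
  proof -
    \<comment> \<open>For fixed \<open>x\<close> and \<open>y\<close> the defect of invariance is a
      polynomial in \<open>A\<close> that vanishes on \<open>G\<close>.\<close>
    have "act A x \<bullet> (S *v act A y) - x \<bullet> (S *v y) = 0"
    proof (rule dense[OF _ _ that])
      show "real_polynomial_function (\<lambda>A. act A x \<bullet> (S *v act A y) - x \<bullet> (S *v y))"
        unfolding inner_vec_def inner_real_def matrix_vector_mult_def vec_lambda_beta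
        by (intro real_polynomial_function_diff real_polynomial_function_sum
            real_polynomial_function.intros(2,4) real_polynomial_function_act finite)
      fix A assume "A \<in> G"
      then show "act A x \<bullet> (S *v act A y) - x \<bullet> (S *v y) = 0"
        by (simp only: form[symmetric] RS diff_self)
    qed
    then show ?thesis by simp
  qed
  define c where "c = S $ 1 $ 1"
  have S: "S = c *\<^sub>R ?J" unfolding c_def using inv by (rule invariant_matrix_eq)
  have "X ** S ** transpose X = c *\<^sub>R Gr"
    unfolding S Gr_def by (simp add: vec_eq_iff matrix_matrix_mult_def sum_distrib_left sum_distrib_right mult_ac)
  then have "\<Phi> Gr = c *\<^sub>R Gr" by (simp only: XSX)
  then have "\<phi> (Gr $ 1 $ 1) = c * Gr $ 1 $ 1" by (simp add: vec_eq_iff \<Phi>_def)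
  moreover have "Gr $ 1 $ 1 = 1" using X[of 1] mink_self by (auto simp: Gr)
  ultimately have "c = 1" using one by simp
  \<comment> \<open>With factor 1, \<open>\<phi>\<close> fixes every entry of \<open>Gr\<close>, and
    its values are rational.\<close>
  then have "Gr $ i $ j \<in> \<rat>" for i j
    using \<open>\<Phi> Gr = c *\<^sub>R Gr\<close> rat[of "Gr $ i $ j"] by (simp add: vec_eq_iff \<Phi>_def)
  then have G: "mink (X $ i) (X $ j) \<in> \<rat>" for i j by (simp add: Gr)
  obtain y y' where y: "cvec C = y v* X" "\<And>i. y $ i \<in> \<rat>" and y': "cvec C' = y' v* X" "\<And>i. y' $ i \<in> \<rat>"
    using coord assms by metis
  have "mink (cvec C) (cvec C') = (\<Sum>i\<in>UNIV. \<Sum>j\<in>UNIV. y $ i * (y' $ j * mink (X $ i) (X $ j)))"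
    unfolding y(1) y'(1) vector_matrix_mult_sum_rows bilinear_sum[OF bilinear_mink]
    by (simp add: bilinear_lmul[OF bilinear_mink] bilinear_rmul[OF bilinear_mink] sum.cartesian_product mult_ac)
  also have "\<dots> \<in> \<rat>" using Rats_mult[OF y(2) Rats_mult[OF y'(2) G]] by (intro Rats_sum)
  finally show ?thesis .
qed

end

section \<open>Normalizing the arrangement\<close>

text \<open>\<open>csqrt a\<close> enters only through its square \<open>a\<close> and its squared
  modulus \<open>cmod a\<close>.\<close>

lemma affine_act_sel:
  assumes "a \<noteq> 0"
  shows "ccenter (affine_act a b C) = (a * ccenter C + b * of_real (curv C)) / of_real (cmod a)"
    and "cocurv (affine_act a b C) = cmod a * cocurv C
      + 2 * Re (ccenter C * (a * cnj b)) / cmod a + curv C * (cmod b)\<^sup>2 / cmod a"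
    and "curv (affine_act a b C) = curv C / cmod a"
proof -
  let ?q = "csqrt a"
  have q: "?q \<noteq> 0" "?q * ?q = a" using assms by (simp_all flip: power2_eq_square)
  have n: "(cmod ?q)\<^sup>2 = cmod a" by (metis norm_power power2_csqrt)
  then have qc: "?q * cnj ?q = of_real (cmod a)" by (metis complex_norm_square)
  have 1: "?q * cnj (1 / ?q) = a / of_real (cmod a)"
    using q assms by (simp add: qc[symmetric] divide_simps)
  have 2: "b / ?q * cnj (1 / ?q) = b / of_real (cmod a)"
    using q assms by (simp add: qc[symmetric])
  have 3: "?q * cnj (b / ?q) = a * cnj b / of_real (cmod a)"
    using q assms by (simp add: qc[symmetric] divide_simps)
  note sel = affine_act_def affine_matrix_def circle_act_simps
  show "ccenter (affine_act a b C) = (a * ccenter C + b * of_real (curv C)) / of_real (cmod a)"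
    using 1 2 by (simp add: sel add_divide_distrib mult_ac qc)
  have "Re (ccenter C * (?q * cnj (b / ?q))) = Re (ccenter C * (a * cnj b)) / cmod a"
    unfolding 3 by (metis Re_divide_of_real times_divide_eq_right)
  then show "cocurv (affine_act a b C) = cmod a * cocurv C
      + 2 * Re (ccenter C * (a * cnj b)) / cmod a + curv C * (cmod b)\<^sup>2 / cmod a"
    by (simp add: sel norm_divide power_divide n)
  show "curv (affine_act a b C) = curv C / cmod a"
    by (simp add: sel norm_divide power_divide n)
qed

context quadratic_irrationality
begin

text \<open>Multiplication by \<open>\<i>\<close> exchanges real and imaginary parts. The new real
  part is then integral, and the new imaginary part is \<open>\<sigma>\<close> times an integer,
  which has integral square.\<close>

lemma imaginary_multiple_mem_ring_of_integers:
  assumes \<sigma>: "\<sigma> / s \<in> \<rat>" "\<sigma>\<^sup>2 \<in> \<int>" and y: "Re y \<in> \<rat>"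
    and int: "of_int M * Re y \<in> \<int>" "of_int M * (\<sigma> * Im y) \<in> \<int>"
  shows "\<i> * of_real (of_int M * \<sigma>) * y \<in> \<O>"
proof -
  let ?z = "\<i> * of_real (of_int M * \<sigma>) * y"
  have Re: "Re ?z = - (of_int M * (\<sigma> * Im y))" and Im: "Im ?z / s = of_int M * (\<sigma> / s) * Re y"
    by simp_all
  have "Re ?z \<in> \<int>" unfolding Re using int(2) by (rule Ints_minus)
  then have "Re ?z \<in> \<rat>" "2 * Re ?z \<in> \<int>" using Ints_subset_Rats by (blast, blast intro: Ints_mult Ints_numeral)
  moreover have "Im ?z / s \<in> \<rat>" unfolding Im using \<sigma>(1) y by (intro Rats_mult) auto
  moreover have "(cmod ?z)\<^sup>2 = \<sigma>\<^sup>2 * (of_int M * Re y)\<^sup>2 + (of_int M * (\<sigma> * Im y))\<^sup>2"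
    unfolding cmod_power2 by (simp add: power_mult_distrib algebra_simps)
  moreover have "\<sigma>\<^sup>2 * (of_int M * Re y)\<^sup>2 + (of_int M * (\<sigma> * Im y))\<^sup>2 \<in> \<int>"
    using Ints_add[OF Ints_mult[OF \<sigma>(2) Ints_power[OF int(1)]] Ints_power[OF int(2)]] .
  ultimately show ?thesis unfolding mem_ring_of_integers_iff by (simp only: quadratic_field_def mem_Collect_eq simp_thms)
qed

end

context integral_orbit
begin

theorem affine_image_subset_S_circles:
  "\<exists>K (D::real) a b. imaginary_quadratic_field K \<and> D \<noteq> 0 \<and> a \<noteq> 0 \<and>
     (\<forall>C\<in>\<A>. affine_act a b C \<in> S_circles K D)"
proof -
  have "linear (\<lambda>x::real^4. x $ 4)" by (rule linearI) auto
  then obtain C0 where C0: "C0 \<in> \<A>" "curv C0 \<noteq> 0"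
    using ex_linear_cvec_nonzero[of "\<lambda>x. x $ 4" "axis 4 1"] by auto
  define z0 r0 where "z0 = ccenter C0" and "r0 = curv C0"
  have r0: "r0 \<noteq> 0" using C0 by (simp add: r0_def)
  have z0: "(cmod z0)\<^sup>2 = 1 + r0 * cocurv C0"
    using C0 circles by (auto simp: z0_def r0_def oriented_circles_def)
  have rat_curv: "l * curv C \<in> \<rat>" if "C \<in> \<A>" for C
    using integral[OF that] Ints_subset_Rats by blast

  \<comment> \<open>Translating the center of \<open>C0\<close> to \<open>0\<close> makes the cocurvature \<open>H\<close> an expression in the curvature and
    the rational pairing with \<open>C0\<close>; \<open>Z\<close> is the new curvature-center.\<close>
  define Z where "Z = (\<lambda>x::real^4. Complex (x $ 1) (x $ 2) - of_real (x $ 4) * (z0 / of_real r0))"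
  define H where "H = (\<lambda>x::real^4. x $ 4 / r0\<^sup>2 - 2 * mink x (cvec C0) / r0)"
  have Z: "Z (cvec C) = ccenter C - of_real (curv C) * (z0 / of_real r0)" for C
    by (simp add: Z_def complex_eq_iff)
  have H: "H (cvec C) = cocurv C - 2 * Re (ccenter C * cnj z0) / r0 + curv C * (cmod z0)\<^sup>2 / r0\<^sup>2" for C
    unfolding z0 using r0
    by (simp add: H_def mink_def z0_def r0_def field_simps power2_eq_square)
  have linZ: "linear (\<lambda>x. Re (c * Z x))" "linear (\<lambda>x. Im (c * Z x))" for c
    by (rule linearI; simp add: Z_def algebra_simps add_divide_distrib diff_divide_distrib)+
  have linH: "linear H"
    by (rule linearI) (simp_all add: H_def mink_def algebra_simps add_divide_distrib diff_divide_distrib)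
  \<comment> \<open>Curvatures become rational after multiplication by \<open>l\<close>, the new
    cocurvatures after division by \<open>l\<close>; products of the two are rational as they
    stand.\<close>
  have rat_H: "H (cvec C) / l \<in> \<rat>" if "C \<in> \<A>" for C
  proof -
    have "H (cvec C) / l = l * curv C / (l * curv C0)\<^sup>2 - 2 * mink (cvec C) (cvec C0) / (l * curv C0)"
      using r0 l_pos by (simp add: H_def r0_def field_simps power2_eq_square)
    also have "\<dots> \<in> \<rat>"
      using rat_curv[OF that] rat_curv[OF C0(1)] mink_rational[OF that C0(1)]
      by (intro Rats_diff Rats_divide Rats_power Rats_mult[OF Rats_number_of])
    finally show ?thesis .
  qed
  have rat_Z: "Re (Z (cvec C) * cnj (Z (cvec C'))) \<in> \<rat>" if "C \<in> \<A>" "C' \<in> \<A>" for C C'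
  proof -
    \<comment> \<open>Translation preserves the Minkowski form; its expression in the translated
      data is solved here for the inner product of centers.\<close>
    have "Re (Z (cvec C) * cnj (Z (cvec C')))
      = mink (cvec C) (cvec C') + (curv C * H (cvec C') + H (cvec C) * curv C') / 2"
      unfolding Z H cmod_power2 using r0 by (simp add: mink_def field_simps power2_eq_square)
    also have "\<dots> = mink (cvec C) (cvec C')
        + ((l * curv C) * (H (cvec C') / l) + (H (cvec C) / l) * (l * curv C')) / 2"
      using l_pos by simp
    also have "\<dots> \<in> \<rat>"
      using mink_rational[OF that] Rats_mult[OF rat_curv rat_H] Rats_mult[OF rat_H rat_curv] that
      by (intro Rats_add Rats_divide[OF _ Rats_number_of])
    finally show ?thesis .
  qed

  obtain C1 where C1: "C1 \<in> \<A>" "Re (1 * Z (cvec C1)) \<noteq> 0"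
    using ex_linear_cvec_nonzero[OF linZ(1)[of 1], of "axis 1 1"] by (auto simp: Z_def axis_def)
  define w where "w = Z (cvec C1)"
  have w: "w \<noteq> 0" using C1 by (auto simp: w_def)
  \<comment> \<open>Multiplication by \<open>cnj w\<close> turns inner products with
    \<open>w\<close> into real parts, which are thereby rational.\<close>
  define Y where "Y = (\<lambda>x. cnj w * Z x)"
  have rat_w: "(cmod w)\<^sup>2 \<in> \<rat>"
    using rat_Z[OF C1(1) C1(1)] unfolding cmod_power2 by (simp add: w_def power2_eq_square)
  have rat_ReY: "Re (Y (cvec C)) \<in> \<rat>" if "C \<in> \<A>" for C
    using rat_Z[OF that C1(1)] by (simp add: Y_def w_def mult.commute)
  \<comment> \<open>Rationality of these products makes all imaginary parts rational multiples of a
    single one, \<open>s\<close>, with rational square; this singles out the field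
    \<open>K\<close>.\<close>
  have rat_ImY: "Im (Y (cvec C)) * Im (Y (cvec C')) \<in> \<rat>" if "C \<in> \<A>" "C' \<in> \<A>" for C C'
  proof -
    have "Im (Y (cvec C)) * Im (Y (cvec C'))
      = (cmod w)\<^sup>2 * Re (Z (cvec C) * cnj (Z (cvec C'))) - Re (Y (cvec C)) * Re (Y (cvec C'))"
      unfolding cmod_power2 by (simp add: Y_def power2_eq_square algebra_simps)
    then show ?thesis using rat_w rat_Z[OF that] rat_ReY that by simp
  qed
  \<comment> \<open>On this vector \<open>Z\<close> takes the value \<open>\<i> * w\<close>, so the
    imaginary part of \<open>Y\<close> is not identically zero and is nonzero on some
    circle.\<close>
  have "Im (Y (vector [- Im w, Re w, 0, 0])) = (cmod w)\<^sup>2"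
    unfolding cmod_power2 by (simp add: Y_def Z_def power2_eq_square)
  then obtain C2 where C2: "C2 \<in> \<A>" "Im (Y (cvec C2)) \<noteq> 0"
    using ex_linear_cvec_nonzero[OF linZ(2)[of "cnj w"], of "vector [- Im w, Re w, 0, 0]"] w
    by (auto simp: Y_def)
  define s where "s = \<bar>Im (Y (cvec C2))\<bar>"
  have s2: "s\<^sup>2 = Im (Y (cvec C2)) * Im (Y (cvec C2))" by (simp add: s_def power2_eq_square)
  interpret quadratic_irrationality s
    using C2 rat_ImY[OF C2(1) C2(1)] by unfold_locales (simp_all add: s2, simp add: s_def)
  have ImY_s: "Im (Y (cvec C)) / s \<in> \<rat>" if "C \<in> \<A>" for C
  proof -
    have "Im (Y (cvec C)) * s \<in> \<rat>"
      using rat_ImY[OF that C2(1)] by (auto simp: s_def abs_if)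
    then have "Im (Y (cvec C)) * s / s\<^sup>2 \<in> \<rat>" using s_square by (rule Rats_divide)
    then show ?thesis using s_pos by (simp add: power2_eq_square)
  qed
  obtain \<sigma> where \<sigma>: "\<sigma> > 0" "\<sigma> / s \<in> \<rat>" "\<sigma>\<^sup>2 \<in> \<int>" and disc: "sqrt_disc K = \<i> * complex_of_real \<sigma>"
    by (rule sqrt_disc_quadratic_field)

  have "\<exists>d::int. d > 0 \<and> (\<forall>C\<in>\<A>. of_int d * Re (Y (cvec C)) \<in> \<int>)"
    using linear_bounded_denominators[OF linZ(1)[of "cnj w"]] rat_ReY by (simp add: Y_def)
  then obtain d1 :: int where d1: "d1 > 0" "\<And>C. C \<in> \<A> \<Longrightarrow> of_int d1 * Re (Y (cvec C)) \<in> \<int>" by blast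
  have "\<sigma> * Im (Y (cvec C)) \<in> \<rat>" if "C \<in> \<A>" for C
  proof -
    have "\<sigma> * Im (Y (cvec C)) = (\<sigma> / s) * (Im (Y (cvec C)) / s) * s\<^sup>2"
      using s_pos by (simp add: power2_eq_square)
    also have "\<dots> \<in> \<rat>" using Rats_mult[OF Rats_mult[OF \<sigma>(2) ImY_s[OF that]] s_square] .
    finally show ?thesis .
  qed
  moreover have "linear (\<lambda>x. \<sigma> * Im (Y x))"
    using linear_compose_scale_right[OF linZ(2)[of "cnj w"], of \<sigma>] by (simp add: Y_def)
  ultimately obtain d2 :: int where d2: "d2 > 0" "\<And>C. C \<in> \<A> \<Longrightarrow> of_int d2 * (\<sigma> * Im (Y (cvec C))) \<in> \<int>"
    using linear_bounded_denominators[of "\<lambda>x. \<sigma> * Im (Y x)"] by blast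
  have "(cmod w)\<^sup>2 / l * H (cvec C) \<in> \<rat>" if "C \<in> \<A>" for C
    using Rats_mult[OF rat_w rat_H[OF that]] by simp
  moreover have "linear (\<lambda>x. (cmod w)\<^sup>2 / l * H x)"
    using linear_compose_scale_right[OF linH, of "(cmod w)\<^sup>2 / l"] by simp
  ultimately obtain d3 :: int where d3: "d3 > 0" "\<And>C. C \<in> \<A> \<Longrightarrow> of_int d3 * ((cmod w)\<^sup>2 / l * H (cvec C)) \<in> \<int>"
    using linear_bounded_denominators[of "\<lambda>x. (cmod w)\<^sup>2 / l * H x"] by blast
  define M where "M = d1 * d2 * d3"
  have M: "M > 0" using d1 d2 d3 by (simp add: M_def)
  have M1: "of_int M * Re (Y (cvec C)) \<in> \<int>" and M2: "of_int M * (\<sigma> * Im (Y (cvec C))) \<in> \<int>"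
    and M3: "of_int M * ((cmod w)\<^sup>2 / l * H (cvec C)) \<in> \<int>" if "C \<in> \<A>" for C
    using Ints_mult[OF Ints_of_int[of "d2 * d3"] d1(2)[OF that]]
      Ints_mult[OF Ints_of_int[of "d1 * d3"] d2(2)[OF that]]
      Ints_mult[OF Ints_of_int[of "d1 * d2"] d3(2)[OF that]]
    by (simp_all add: M_def mult_ac)

  \<comment> \<open>The rotation turns \<open>w\<close> into \<open>cmod w\<close>, so that \<open>cmod w\<close> times the new curvature-centers lies in \<open>K\<close>; the
    factor \<open>cmod w / l\<close> makes \<open>cmod w\<close> times the new curvatures and cocurvatures rational.\<close>
  define a b where "a = cnj w / of_real l" and "b = - (a * (z0 / of_real r0))"
  \<comment> \<open>The root of \<open>D\<close> is to be
    \<open>of_int M * cmod w * \<sigma>\<close>: \<open>cmod w\<close> turns the new centers into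
    values of \<open>Y\<close>, \<open>M\<close> clears denominators, and \<open>\<sigma>\<close>
    matches \<open>sqrt_disc K\<close> in the conditions on curvature and cocurvature.\<close>
  define D where "D = (of_int M * cmod w * \<sigma>)\<^sup>2"
  have a: "a \<noteq> 0" "cmod a = cmod w / l" using w l_pos by (simp_all add: a_def norm_divide)
  have root_pos: "of_int M * cmod w * \<sigma> > 0" using M w \<sigma> by simp
  have D: "D \<noteq> 0" using M w \<sigma> by (simp add: D_def)
  have csqrtD: "csqrt (of_real D) = of_real (of_int M * cmod w * \<sigma>)"
    using root_pos by (simp add: D_def csqrt_of_real_nonneg)
  have "affine_act a b C \<in> S_circles K D" if C: "C \<in> \<A>" for C
  proof -
    let ?C = "affine_act a b C" and ?y = "Y (cvec C)"
    have "csqrt a \<noteq> 0" using a by simp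
    then have "?C \<in> oriented_circles"
      unfolding affine_act_def using C circles
      by (intro circle_act_in_oriented_circles) (auto simp: affine_matrix_def det_2)
    have "a * ccenter C + b * of_real (curv C) = a * Z (cvec C)"
      by (simp add: Z b_def algebra_simps)
    then have "of_real (cmod w) * ccenter ?C = ?y"
      using w l_pos a by (simp add: affine_act_sel Y_def) (simp add: a_def)
    then have center: "\<i> * csqrt (of_real D) * ccenter ?C = \<i> * of_real (of_int M * \<sigma>) * ?y"
      unfolding csqrtD by (simp add: mult_ac)
    have cnj_center: "\<i> * csqrt (of_real D) * cnj (ccenter ?C) = \<i> * of_real (of_int M * \<sigma>) * cnj ?y"
      using \<open>_ = ?y\<close>[symmetric] unfolding csqrtD by (simp add: mult_ac)
    have mem: "\<i> * of_real (of_int M * \<sigma>) * ?y \<in> \<O>"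
      using \<sigma> rat_ReY[OF C] M1[OF C] M2[OF C] by (intro imaginary_multiple_mem_ring_of_integers)
    have cnj_mem: "\<i> * of_real (of_int M * \<sigma>) * cnj ?y \<in> \<O>"
      using \<sigma> rat_ReY[OF C] M1[OF C] M2[OF C] by (intro imaginary_multiple_mem_ring_of_integers) simp_all
    obtain m :: int where m: "of_int M * ((cmod w)\<^sup>2 / l * H (cvec C)) = of_int m"
      using M3[OF C] by (auto elim: Ints_cases)
    \<comment> \<open>By the choice of \<open>b\<close>, \<open>a * cnj b\<close> is a real multiple
      of \<open>cnj z0\<close>; this brings the new cocurvature to the form
      \<open>cmod a * H (cvec C)\<close>.\<close>
    have re: "Re (ccenter C * (a * cnj b)) = - ((cmod a)\<^sup>2 * Re (ccenter C * cnj z0) / r0)"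
    proof -
      have "ccenter C * (a * cnj b) = - ((a * cnj a) * (ccenter C * cnj z0) / of_real r0)"
        by (simp add: b_def)
      also have "\<dots> = of_real (- (cmod a)\<^sup>2 / r0) * (ccenter C * cnj z0)"
        by (simp flip: complex_norm_square)
      finally have "Re (ccenter C * (a * cnj b)) = Re (of_real (- (cmod a)\<^sup>2 / r0) * (ccenter C * cnj z0))"
        by (rule arg_cong)
      moreover have "Re (of_real t * u) = t * Re u" for t u by simp
      ultimately show ?thesis by (simp only:) simp
    qed
    have sq: "(cmod b)\<^sup>2 = (cmod a)\<^sup>2 * ((cmod z0)\<^sup>2 / r0\<^sup>2)"
      by (simp add: b_def norm_mult norm_divide power_mult_distrib power_divide)
    have "cocurv ?C = cmod a * cocurv C + 2 * - ((cmod a)\<^sup>2 * Re (ccenter C * cnj z0) / r0) / cmod a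
        + curv C * ((cmod a)\<^sup>2 * ((cmod z0)\<^sup>2 / r0\<^sup>2)) / cmod a"
      by (simp only: affine_act_sel(2)[OF a(1)] re sq)
    also have "\<dots> = cmod a * H (cvec C)"
    proof -
      have "x * p + 2 * - (x\<^sup>2 * e / r0) / x + q * (x\<^sup>2 * (f / r0\<^sup>2)) / x
          = x * (p - 2 * e / r0 + q * f / r0\<^sup>2)" if "x \<noteq> 0" for x p e q f :: real
        using that by (simp add: power2_eq_square algebra_simps)
      then show ?thesis unfolding H using a(1) by (simp only: norm_eq_zero simp_thms)
    qed
    finally have cocurv: "cocurv ?C = cmod a * H (cvec C)" .
    have "cmod w * cocurv ?C = (cmod w)\<^sup>2 / l * H (cvec C)"
      using l_pos by (simp add: cocurv a power2_eq_square)
    then have "(of_int M * cmod w * \<sigma>) * cocurv ?C = \<sigma> * of_int m"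
      using m by (simp add: mult_ac)
    then have m: "\<i> * csqrt (of_real D) * of_real (cocurv ?C) = sqrt_disc K * of_int m"
      unfolding csqrtD disc by (metis mult.assoc of_real_mult of_real_of_int_eq)
    obtain k :: int where k: "l * curv C = of_int k"
      using integral[OF C] by (auto elim: Ints_cases)
    have "(of_int M * cmod w * \<sigma>) * curv ?C = \<sigma> * of_int (M * k)"
      using l_pos w a by (simp add: affine_act_sel k[symmetric])
    then have k: "\<i> * csqrt (of_real D) * of_real (curv ?C) = sqrt_disc K * of_int (M * k)"
      unfolding csqrtD disc by (metis mult.assoc of_real_mult of_real_of_int_eq)
    show ?thesis
      unfolding S_circles_def mem_Collect_eq center cnj_center
      using \<open>?C \<in> oriented_circles\<close> mem cnj_mem m k by (intro conjI exI)
  qed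
  then show ?thesis using imaginary_quadratic_field D a by blast
qed

end

section \<open>Passage from \<open>PSL2C\<close> to matrices\<close>

lemma imaginary_quadratic_field_exists: "\<exists>K. imaginary_quadratic_field K"
proof -
  \<comment> \<open>The Gaussian field, which serves for the empty arrangement.\<close>
  interpret quadratic_irrationality 1 by unfold_locales simp_all
  show ?thesis using imaginary_quadratic_field by blast
qed

theorem theorem4p2:
  fixes \<A> :: "oriented_circle set" and \<Gamma> :: "(complex ^ 2 ^ 2) set set"
  assumes "integral_arrangement \<A>"
    and "subgroup \<Gamma> PSL2C" and "zariski_dense \<Gamma>"
    and "\<forall>M\<in>\<Gamma>. psl_act M ` \<A> = \<A>"
  shows "\<exists>K (D::real) a b. imaginary_quadratic_field K \<and> D \<noteq> 0 \<and> a \<noteq> 0 \<and>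
           (\<forall>C\<in>\<A>. affine_act a b C \<in> S_circles K D)"
proof (cases "\<A> = {}")
  case True
  then show ?thesis using imaginary_quadratic_field_exists by (metis empty_iff zero_neq_one)
next
  case False
  obtain l :: real where l: "l \<noteq> 0" "\<And>C. C \<in> \<A> \<Longrightarrow> l * curv C \<in> \<int>"
    and circles: "\<A> \<subseteq> oriented_circles"
    using assms(1) by (auto simp: integral_arrangement_def arrangement_def)
  have sub: "\<Gamma> \<subseteq> carrier PSL2C" using assms(2) by (rule subgroup.subset)
  interpret integral_orbit \<A> "\<Union>\<Gamma>" "\<bar>l\<bar>"
  proof
    show "\<bar>l\<bar> * curv C \<in> \<int>" if "C \<in> \<A>" for C
      using l(2)[OF that] by (auto simp: abs_if)
    show "circle_act A C \<in> \<A>" if A: "A \<in> \<Union>\<Gamma>" and C: "C \<in> \<A>" for A C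
    proof -
      obtain M where M: "M \<in> \<Gamma>" "A \<in> M" using A by blast
      then have "psl_act M C = circle_act A C" using sub by (intro psl_act_eq) auto
      then show ?thesis using assms(4) M C by (metis image_eqI)
    qed
    show "det A = 1" if A: "A \<in> \<Union>\<Gamma>" for A
    proof -
      obtain M where "M \<in> carrier PSL2C" "A \<in> M" using A sub by blast
      then show ?thesis by (auto simp: carrier_PSL2C det_uminus_2)
    qed
    fix p :: "complex^2^2 \<Rightarrow> real" and B :: "complex^2^2"
    assume p: "real_polynomial_function p" "\<And>A. A \<in> \<Union>\<Gamma> \<Longrightarrow> p A = 0" and "det B = 1"
    \<comment> \<open>The closed set cut out by \<open>p\<close> alone contains
      \<open>\<Gamma>\<close>, so by density it is the whole group.\<close>
    let ?Z = "{M \<in> carrier PSL2C. \<forall>A\<in>M. \<forall>q\<in>{p}. q A = 0}"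
    have "zariski_closed ?Z" unfolding zariski_closed_def using p(1) by blast
    moreover have "\<Gamma> \<subseteq> ?Z" using p(2) sub by auto
    ultimately have "?Z = carrier PSL2C" using assms(3) unfolding zariski_dense_def by blast
    moreover have "{B, - B} \<in> carrier PSL2C" unfolding carrier_PSL2C using \<open>det B = 1\<close> by blast
    ultimately have "{B, - B} \<in> ?Z" by simp
    then show "p B = 0" by simp
  qed (use l circles False in auto)
  show ?thesis by (rule affine_image_subset_S_circles)
qed

end
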